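(* Let $G$ be a finite non-abelian group with commuting graph $\Gamma_G$. If $G$ is not isomorphic to the symmetric group $S_4$ and $\Gamma_G$ is planar, then $G$ is super integral.
   Context: The commuting graph $\Gamma_G$ of a finite non-abelian group $G$ with center $Z(G)$ is the simple undirected graph with vertex set $G\setminus Z(G)$ in which two distinct vertices $x,y$ are adjacent if and only if $xy=yx$. A graph is planar if its genus is zero, i.e. it can be embedded in the sphere. Let $A$ be the adjacency matrix and $D$ the (diagonal) degree matrix of $\Gamma_G$. A finite non-abelian group $G$ is called super integral if all eigenvalues of $A$, all eigenvalues of the Laplacian matrix $D-A$, and all eigenvalues of the signless Laplacian matrix $D+A$ are integers. *)

theory Defs
  imports
    "HOL-Algebra.Sym_Groups"
    "HOL-Analysis.Analysis"
    "Jordan_Normal_Form.Spectral_Radius"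
begin

definition group_center :: "('g, 'b) monoid_scheme \<Rightarrow> 'g set" where
  "group_center G =
     {z \<in> carrier G. \<forall>g \<in> carrier G. z \<otimes>\<^bsub>G\<^esub> g = g \<otimes>\<^bsub>G\<^esub> z}"

text \<open>Simple undirected graphs are given by a vertex set together with a set of
  two-element sets of vertices.\<close>

definition commuting_verts :: "('g, 'b) monoid_scheme \<Rightarrow> 'g set" where
  "commuting_verts G = carrier G - group_center G"

definition commuting_edges :: "('g, 'b) monoid_scheme \<Rightarrow> 'g set set" where
  "commuting_edges G =
     {{x, y} | x y. x \<in> commuting_verts G \<and> y \<in> commuting_verts G \<and> x \<noteq> y \<and>
                    x \<otimes>\<^bsub>G\<^esub> y = y \<otimes>\<^bsub>G\<^esub> x}"

text \<open>A drawing on the unit sphere of \<open>\<real>\<^sup>3\<close>: \<open>p\<close> places the vertices at distinct points,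
  \<open>\<gamma> e\<close> is an arc joining the two ends of \<open>e\<close> that meets no other vertex, and distinct
  edges meet at most in the images of their common ends.\<close>

definition sphere_embedding ::
  "'v set \<Rightarrow> 'v set set \<Rightarrow> ('v \<Rightarrow> real^3) \<Rightarrow> ('v set \<Rightarrow> real \<Rightarrow> real^3) \<Rightarrow> bool" where
  "sphere_embedding V E p \<gamma> \<longleftrightarrow>
     inj_on p V \<and> p ` V \<subseteq> sphere 0 1 \<and>
     (\<forall>e \<in> E. arc (\<gamma> e) \<and> path_image (\<gamma> e) \<subseteq> sphere 0 1 \<and>
        {pathstart (\<gamma> e), pathfinish (\<gamma> e)} = p ` e \<and>
        path_image (\<gamma> e) \<inter> p ` V = p ` e) \<and>
     (\<forall>e \<in> E. \<forall>f \<in> E. e \<noteq> f \<longrightarrow> path_image (\<gamma> e) \<inter> path_image (\<gamma> f) = p ` (e \<inter> f))"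

definition planar_graph :: "'v set \<Rightarrow> 'v set set \<Rightarrow> bool" where
  "planar_graph V E \<longleftrightarrow> (\<exists>p \<gamma>. sphere_embedding V E p \<gamma>)"

text \<open>The matrices are taken with respect to an enumeration \<open>vs\<close> of the vertices (a list in
  which every vertex occurs exactly once). They have complex entries, so that all complex
  eigenvalues are taken into account.\<close>

definition adjacency_matrix :: "'v set set \<Rightarrow> 'v list \<Rightarrow> complex mat" where
  "adjacency_matrix E vs =
     mat (length vs) (length vs) (\<lambda>(i, j). if {vs ! i, vs ! j} \<in> E then 1 else 0)"

definition degree_matrix :: "'v set set \<Rightarrow> 'v list \<Rightarrow> complex mat" where
  "degree_matrix E vs =
     mat (length vs) (length vs)
       (\<lambda>(i, j). if i = j then of_nat (card {e \<in> E. vs ! i \<in> e}) else 0)"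

definition laplacian_matrix :: "'v set set \<Rightarrow> 'v list \<Rightarrow> complex mat" where
  "laplacian_matrix E vs = degree_matrix E vs - adjacency_matrix E vs"

definition signless_laplacian_matrix :: "'v set set \<Rightarrow> 'v list \<Rightarrow> complex mat" where
  "signless_laplacian_matrix E vs = degree_matrix E vs + adjacency_matrix E vs"

text \<open>The three spectra do not depend on the enumeration of the vertices; the definition
  quantifies over all of them. For a finite group there is at least one.\<close>

definition super_integral :: "('g, 'b) monoid_scheme \<Rightarrow> bool" where
  "super_integral G \<longleftrightarrow>
     (\<forall>vs. distinct vs \<and> set vs = commuting_verts G \<longrightarrow>
        spectrum (adjacency_matrix (commuting_edges G) vs) \<subseteq> \<int> \<and>
        spectrum (laplacian_matrix (commuting_edges G) vs) \<subseteq> \<int> \<and>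
        spectrum (signless_laplacian_matrix (commuting_edges G) vs) \<subseteq> \<int>)"

end

theory Submission
  imports Defs "HOL-Algebra.Group_Action"
begin

text \<open>The only facts about planarity and about the spectra that enter are that \<open>K\<^sub>5\<close> is not planar
  and that a disjoint union of cliques has integral spectra. So it suffices to show that a group
  without five pairwise commuting non-central elements is either isomorphic to \<open>S\<^sub>4\<close> or has only
  abelian centralizers of non-central elements, for then commuting is transitive on the vertices.

  Write \<open>C S\<close> for the centralizer of \<open>S\<close>. If \<open>x\<close> is not central and \<open>C {x}\<close> is not abelian, let \<open>y\<close> be a
  non-central element of \<open>C {x}\<close>. Then \<open>Z(G) < C (C {x}) < C (C {x, y})\<close> are abelian groups, and as
  the last one has at most \<open>|Z(G)| + 4\<close> elements, their orders are \<open>1\<close>, \<open>2\<close>, \<open>4\<close>. Counting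
  conjugates inside \<open>C {x}\<close> gives \<open>|C {x}| = 8\<close>. All non-trivial elements of \<open>G\<close> thus have a
  centralizer of order \<open>2\<close>, \<open>3\<close>, \<open>4\<close>, \<open>5\<close> or \<open>8\<close>, and the class equation leaves \<open>|G| = 24\<close> and \<open>|G| = 40\<close>. In the first case \<open>G\<close> acts
  faithfully on its four subgroups of order \<open>3\<close>; in the second, there would be five commuting
  involutions.\<close>

section \<open>Non-planarity of the complete graph on five vertices\<close>

lemma connected_arc_minus_pathstart:
  fixes d :: "real \<Rightarrow> 'a::t2_space"
  assumes "arc d"
  shows "connected (path_image d - {pathstart d})"
proof -
  have inj: "inj_on d {0..1}" and cont: "continuous_on {0..1} d"
    using assms by (auto simp: arc_def path_def)
  have "connected (d ` {0<..1})"
    by (intro connected_continuous_image continuous_on_subset [OF cont]) auto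
  moreover have "d ` ({0..1} - {0}) = d ` {0..1} - d ` {0}"
    by (rule inj_on_image_set_diff [OF inj]) auto
  moreover have "{0..1} - {0} = {0<..1 :: real}"
    by auto
  ultimately show ?thesis
    by (simp add: path_image_def pathstart_def)
qed

text \<open>An open arc is connected, and the complement of the curve is the disjoint union of two
  open sets.\<close>

lemma endless_arc_side:
  fixes c :: "real \<Rightarrow> complex"
  assumes "simple_path c" "pathfinish c = pathstart c" "arc d"
    and disj: "(path_image d - {pathstart d, pathfinish d}) \<inter> path_image c = {}"
  shows "path_image d - {pathstart d, pathfinish d} \<subseteq> inside (path_image c) \<or>
         path_image d - {pathstart d, pathfinish d} \<subseteq> outside (path_image c)"
proof -
  let ?D = "path_image d - {pathstart d, pathfinish d}"
  have "connected ?D"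
    using assms arc_imp_simple_path connected_simple_path_endless by blast
  moreover have "?D \<subseteq> inside (path_image c) \<union> outside (path_image c)"
    using disj by (auto simp: inside_Un_outside)
  ultimately have "inside (path_image c) \<inter> ?D = {} \<or> outside (path_image c) \<inter> ?D = {}"
    using Jordan_inside_outside [OF assms(1,2)]
    by (intro connectedD) auto
  then show ?thesis
    using \<open>?D \<subseteq> _\<close> by blast
qed

text \<open>From \<open>u\<close>, run along \<open>d\<close> to its end on \<open>B\<close>. That
  point lies in the closure of \<open>W\<close>, so adding it to \<open>W\<close> keeps
  \<open>W\<close> connected, and it avoids \<open>A\<close> and \<open>c\<close>. Hence
  \<open>x\<close> is reached without meeting \<open>A\<close> or \<open>c\<close>.\<close>

lemma connected_avoiding_half_theta:
  fixes A B c d :: "real \<Rightarrow> complex"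
  assumes "arc d" and AB: "path_image A \<inter> path_image B = {a, b}" and "{a, b} \<subseteq> path_image c"
    and q: "pathfinish d \<in> path_image B"
    and cU: "path_image c - {a, b} \<subseteq> U" and dU: "path_image d - {pathstart d, pathfinish d} \<subseteq> U"
    and W: "connected W" "U \<inter> W = {}" "(U \<union> W) \<inter> (path_image A \<union> path_image B) = {}"
      "path_image B \<subseteq> closure W"
    and cd: "path_image c \<inter> path_image d = {}"
    and x: "x \<in> W" and u: "u \<in> path_image d - {pathstart d, pathfinish d}"
  shows "connected_component (- (path_image A \<union> path_image c)) u x"
proof -
  have qd: "pathfinish d \<in> path_image d" "pathfinish d \<noteq> pathstart d"
    using \<open>arc d\<close> arc_distinct_ends by force+
  have "connected (W \<union> {pathfinish d})"
    using W q by (intro connected_intermediate_closure [OF \<open>connected W\<close>]) (auto intro: closure_subset [THEN subsetD])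
  then have C: "connected ((path_image d - {pathstart d}) \<union> (W \<union> {pathfinish d}))" (is "connected ?C")
    by (rule connected_Un [OF connected_arc_minus_pathstart [OF \<open>arc d\<close>]]) (use qd in blast)
  have "pathfinish d \<notin> path_image A \<union> path_image c"
    using q AB \<open>{a, b} \<subseteq> path_image c\<close> cd qd by blast
  moreover have "W \<inter> path_image c = {}"
    using cU W AB by blast
  ultimately have "?C \<subseteq> - (path_image A \<union> path_image c)"
    using dU W cd by blast
  with C show ?thesis
    unfolding connected_component_def using x u by blast
qed

text \<open>Janiszewski's theorem for \<open>A \<union> c\<close> and \<open>B \<union> c\<close>, whose intersection is the connected set \<open>c\<close>:
  if \<open>c\<close> and \<open>d\<close> were disjoint, neither of the two sets would separate \<open>d\<close> from the other side \<open>W\<close>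
  of the Jordan curve \<open>A \<union> B\<close>, hence neither would their union.\<close>

lemma crossing_arcs_in_Jordan_side:
  fixes A B c d :: "real \<Rightarrow> complex"
  assumes "arc A" "arc B" "arc c" "arc d"
    and ends: "pathstart A = a" "pathfinish A = b" "pathstart B = a" "pathfinish B = b"
      "pathstart c = a" "pathfinish c = b"
    and AB: "path_image A \<inter> path_image B = {a, b}"
    and pq: "pathstart d \<in> path_image A" "pathfinish d \<in> path_image B"
    and UW: "(U, W) \<in> {(inside J, outside J), (outside J, inside J)}"
    and J: "J = path_image A \<union> path_image B"
    and cU: "path_image c - {a, b} \<subseteq> U" and dU: "path_image d - {pathstart d, pathfinish d} \<subseteq> U"
  shows "path_image c \<inter> path_image d \<noteq> {}"
proof
  assume cd: "path_image c \<inter> path_image d = {}"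
  have "simple_path (A +++ reversepath B)"
    using assms by (intro simple_path_join_loop) (auto simp: arc_reversepath)
  moreover have "path_image (A +++ reversepath B) = J"
    using ends J by (simp add: path_image_join)
  ultimately have Jordan: "inside J \<noteq> {} \<and> connected (inside J) \<and> outside J \<noteq> {} \<and> connected (outside J) \<and>
      inside J \<inter> outside J = {} \<and> inside J \<union> outside J = - J \<and>
      frontier (inside J) = J \<and> frontier (outside J) = J"
    using Jordan_inside_outside [of "A +++ reversepath B"] ends by simp
  moreover have "U = inside J \<and> W = outside J \<or> U = outside J \<and> W = inside J"
    using UW by simp
  ultimately have W: "W \<noteq> {}" "connected W" "U \<inter> W = {}" "U \<union> W = - J" "frontier W = J"
    by (metis Int_commute Un_commute)+
  then have W: "W \<noteq> {}" "connected W" "U \<inter> W = {}" "(U \<union> W) \<inter> J = {}" "J \<subseteq> closure W"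
    by (auto simp: frontier_def)
  have abc: "{a, b} \<subseteq> path_image c"
    using AB by (metis ends(5,6) bot.extremum insert_subset pathfinish_in_path_image pathstart_in_path_image)
  obtain x where x: "x \<in> W"
    using W by blast
  obtain u where u: "u \<in> path_image d - {pathstart d, pathfinish d}"
    using nonempty_simple_path_endless [OF arc_imp_simple_path [OF \<open>arc d\<close>]] by blast
  have 1: "connected_component (- (path_image A \<union> path_image c)) u x"
    using assms(4) AB abc pq(2) cU dU W cd x u unfolding J
    by (intro connected_avoiding_half_theta [where d = d and U = U and W = W]) auto
  \<comment> \<open>Reversing \<open>d\<close> exchanges the roles of \<open>A\<close> and
    \<open>B\<close>.\<close>
  have 2: "connected_component (- (path_image B \<union> path_image c)) u x"
    using assms(4) AB abc pq(1) cU dU W cd x u unfolding J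
    by (intro connected_avoiding_half_theta [where B = A and d = "reversepath d" and U = U and W = W])
      (auto simp: arc_reversepath)
  have "(path_image A \<union> path_image c) \<inter> (path_image B \<union> path_image c) = path_image c"
    using AB abc by blast
  then have "connected_component (- ((path_image A \<union> path_image c) \<union> (path_image B \<union> path_image c))) u x"
    using 1 2 assms(1-3)
    by (intro Janiszewski [where S = "path_image A \<union> path_image c" and T = "path_image B \<union> path_image c"])
      (simp_all only: compact_Un closed_Un compact_arc_image closed_arc_image connected_arc_image)
  then have "connected_component (- J) u x"
    by (rule connected_component_of_subset) (use J in auto)
  \<comment> \<open>\<open>u\<close> and \<open>x\<close> lie on different sides of
    \<open>J\<close>.\<close>
  then show False
    using UW W(3) u dU x inside_same_component [of J u x] outside_same_component [of J u x] by blast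
qed

text \<open>Vertices that are not on any edge are ignored: in the passage from the sphere to the plane, such
  a vertex may be the centre of the stereographic projection.\<close>

definition plane_embedding ::
  "'v set set \<Rightarrow> ('v \<Rightarrow> complex) \<Rightarrow> ('v set \<Rightarrow> real \<Rightarrow> complex) \<Rightarrow> bool" where
  "plane_embedding E p \<gamma> \<longleftrightarrow>
     inj_on p (\<Union>E) \<and>
     (\<forall>e \<in> E. arc (\<gamma> e) \<and> {pathstart (\<gamma> e), pathfinish (\<gamma> e)} = p ` e) \<and>
     (\<forall>e \<in> E. \<forall>f \<in> E. e \<noteq> f \<longrightarrow> path_image (\<gamma> e) \<inter> path_image (\<gamma> f) = p ` (e \<inter> f))"

text \<open>The cycle \<open>v1 v3 v2 v4\<close> has two sides. The edges \<open>v1 v2\<close> and \<open>v3 v4\<close> and the vertex \<open>v5\<close> (with the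
  paths \<open>v1 v5 v2\<close> and \<open>v3 v5 v4\<close>) would have to lie on pairwise different sides.\<close>

lemma plane_embedding_no_K5:
  assumes emb: "plane_embedding E p \<gamma>"
    and K: "card K = 5" and edge: "\<And>x y. x \<in> K \<Longrightarrow> y \<in> K \<Longrightarrow> x \<noteq> y \<Longrightarrow> {x, y} \<in> E"
  shows False
proof -
  obtain v1 v2 v3 v4 v5 where v: "K = {v1, v2, v3, v4, v5}" and dist: "distinct [v1, v2, v3, v4, v5]"
  proof -
    obtain vs where vs: "set vs = K" "distinct vs"
      using K finite_distinct_list [of K] card_ge_0_finite [of K] by auto
    then have "length vs = 5"
      using K distinct_card by fastforce
    then obtain v1 v2 v3 v4 v5 where "vs = [v1, v2, v3, v4, v5]"
      by (auto simp: numeral_eq_Suc length_Suc_conv)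
    with vs that show thesis by auto
  qed
  have "x \<in> \<Union>E" if "x \<in> K" for x
  proof -
    have "\<exists>y\<in>K. y \<noteq> x"
      using dist unfolding v by auto
    then show ?thesis
      using edge [OF that] by blast
  qed
  then have inj: "inj_on p K"
    using emb inj_on_subset [of p "\<Union>E" K] unfolding plane_embedding_def by blast
  note dist = dist distinct_rev [THEN iffD2, OF dist, simplified]
  have p: "p x = p y \<longleftrightarrow> x = y" if "x \<in> K" "y \<in> K" for x y
    using inj that by (auto simp: inj_on_def)
  \<comment> \<open>An edge is an unordered pair whose arc may run either way; \<open>g x y\<close>
    is that arc oriented from \<open>x\<close> to \<open>y\<close>.\<close>
  define g where "g x y = (if pathstart (\<gamma> {x, y}) = p x then \<gamma> {x, y} else reversepath (\<gamma> {x, y}))" for x y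
  define I where "I x y = path_image (g x y)" for x y
  have g: "arc (g x y)" "pathstart (g x y) = p x" "pathfinish (g x y) = p y" "I x y = path_image (\<gamma> {x, y})"
    if "x \<in> K" "y \<in> K" "x \<noteq> y" for x y
  proof -
    have "arc (\<gamma> {x, y})" "{pathstart (\<gamma> {x, y}), pathfinish (\<gamma> {x, y})} = {p x, p y}"
      using emb edge [OF that] unfolding plane_embedding_def by auto
    then show "arc (g x y)" "pathstart (g x y) = p x" "pathfinish (g x y) = p y" "I x y = path_image (\<gamma> {x, y})"
      unfolding g_def I_def by (auto simp: doubleton_eq_iff arc_reversepath)
  qed
  have gint: "I x y \<inter> I z w = p ` ({x, y} \<inter> {z, w})"
    if "x \<in> K" "y \<in> K" "x \<noteq> y" "z \<in> K" "w \<in> K" "z \<noteq> w" "{x, y} \<noteq> {z, w}" for x y z w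
    using emb edge [OF that(1-3)] edge [OF that(4-6)] that unfolding plane_embedding_def
    by (simp add: g(4))
  have ends: "p x \<in> I x y" "p y \<in> I x y" if "x \<in> K" "y \<in> K" "x \<noteq> y" for x y
    using g(2,3) [OF that] unfolding I_def by (metis pathstart_in_path_image, metis pathfinish_in_path_image)
  define h where "h x y z = g x y +++ g y z" for x y z
  have h: "arc (h x y z)" "pathstart (h x y z) = p x" "pathfinish (h x y z) = p z"
      "path_image (h x y z) = I x y \<union> I y z"
    if "x \<in> K" "y \<in> K" "z \<in> K" "x \<noteq> y" "y \<noteq> z" "x \<noteq> z" for x y z
  proof -
    have "I x y \<inter> I y z = {p y}"
      using gint [of x y y z] that by (auto simp: doubleton_eq_iff)
    then show "arc (h x y z)"
      unfolding h_def using g that by (intro arc_join) (auto simp: I_def)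
    show "pathstart (h x y z) = p x" "pathfinish (h x y z) = p z"
      "path_image (h x y z) = I x y \<union> I y z"
      unfolding h_def I_def using g that by (auto simp: path_image_join)
  qed
  let ?A = "h v1 v3 v2" and ?B = "h v1 v4 v2"
  define J where "J = path_image ?A \<union> path_image ?B"
  have vK: "v1 \<in> K" "v2 \<in> K" "v3 \<in> K" "v4 \<in> K" "v5 \<in> K"
    using v by auto
  have im_AB: "path_image ?A = I v1 v3 \<union> I v3 v2" "path_image ?B = I v1 v4 \<union> I v4 v2"
    using dist by (simp_all add: h vK)
  have AB: "path_image ?A \<inter> path_image ?B = {p v1, p v2}"
    unfolding im_AB using dist
    by (simp add: Int_Un_distrib Int_Un_distrib2 gint vK doubleton_eq_iff insert_commute)
  have J: "simple_path (?A +++ reversepath ?B)" "path_image (?A +++ reversepath ?B) = J"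
    "pathfinish (?A +++ reversepath ?B) = pathstart (?A +++ reversepath ?B)"
    using AB dist unfolding J_def
    by (auto simp: h vK path_image_join arc_reversepath intro!: simple_path_join_loop)
  have Jeq: "J = I v1 v3 \<union> I v3 v2 \<union> (I v1 v4 \<union> I v4 v2)"
    unfolding J_def im_AB ..
  have side: "path_image d - {pathstart d, pathfinish d} \<subseteq> inside J \<or>
      path_image d - {pathstart d, pathfinish d} \<subseteq> outside J"
    if "arc d" "path_image d \<inter> J \<subseteq> {pathstart d, pathfinish d}" for d
    using endless_arc_side [OF J(1,3), of d] that unfolding J(2) by blast
  have cross: False if "arc c" "arc d" "pathstart c = p v1" "pathfinish c = p v2"
    "pathstart d = p v3" "pathfinish d = p v4" "path_image c \<inter> path_image d = {}"
    "(U, W) \<in> {(inside J, outside J), (outside J, inside J)}"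
    "path_image c - {p v1, p v2} \<subseteq> U" "path_image d - {p v3, p v4} \<subseteq> U" for c d U W
  proof -
    have "path_image c \<inter> path_image d \<noteq> {}"
      using that dist AB
      by (intro crossing_arcs_in_Jordan_side [where A = ?A and B = ?B and J = J and U = U and W = W])
        (auto simp: h vK J_def ends)
    with that show False by blast
  qed
  let ?c = "g v1 v2" and ?d = "g v3 v4" and ?c' = "h v1 v5 v2" and ?d' = "h v3 v5 v4"
  have arcs: "arc ?c" "arc ?d" "arc ?c'" "arc ?d'"
    using dist by (auto simp: g h vK)
  have start: "pathstart ?c = p v1" "pathfinish ?c = p v2" "pathstart ?d = p v3" "pathfinish ?d = p v4"
    "pathstart ?c' = p v1" "pathfinish ?c' = p v2" "pathstart ?d' = p v3" "pathfinish ?d' = p v4"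
    using dist by (auto simp: g h vK)
  have im: "path_image ?c = I v1 v2" "path_image ?d = I v3 v4"
    "path_image ?c' = I v1 v5 \<union> I v5 v2" "path_image ?d' = I v3 v5 \<union> I v5 v4"
    using dist by (auto simp: h vK I_def)
  have disj: "path_image ?c \<inter> path_image ?d = {}" "path_image ?c \<inter> path_image ?d' = {}"
    "path_image ?c' \<inter> path_image ?d = {}"
    unfolding im using dist by (simp_all add: Int_Un_distrib Int_Un_distrib2 gint vK doubleton_eq_iff)
  have c: "path_image ?c - {p v1, p v2} \<subseteq> inside J \<or> path_image ?c - {p v1, p v2} \<subseteq> outside J"
    using side [of ?c] arcs dist unfolding start im Jeq
    by (simp add: Int_Un_distrib gint vK doubleton_eq_iff)
  have d: "path_image ?d - {p v3, p v4} \<subseteq> inside J \<or> path_image ?d - {p v3, p v4} \<subseteq> outside J"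
    using side [of ?d] arcs dist unfolding start im Jeq
    by (simp add: Int_Un_distrib gint vK doubleton_eq_iff)
  have c': "path_image ?c' - {p v1, p v2} \<subseteq> inside J \<or> path_image ?c' - {p v1, p v2} \<subseteq> outside J"
    using side [of ?c'] arcs dist unfolding start im Jeq
    by (simp add: Int_Un_distrib Int_Un_distrib2 gint vK doubleton_eq_iff)
  have d': "path_image ?d' - {p v3, p v4} \<subseteq> inside J \<or> path_image ?d' - {p v3, p v4} \<subseteq> outside J"
    using side [of ?d'] arcs dist unfolding start im Jeq
    by (simp add: Int_Un_distrib Int_Un_distrib2 gint vK doubleton_eq_iff)
  have v5: "p v5 \<in> path_image ?c' - {p v1, p v2}" "p v5 \<in> path_image ?d' - {p v3, p v4}"
    unfolding im using dist by (auto simp: ends p vK)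
  \<comment> \<open>\<open>?c'\<close> and \<open>?d'\<close> share the point \<open>p v5\<close>,
    which is off the cycle.\<close>
  have same_side: "path_image ?d' - {p v3, p v4} \<subseteq> X"
    if "path_image ?c' - {p v1, p v2} \<subseteq> X" "X \<in> {inside J, outside J}" for X
    using d' v5 that inside_Int_outside [of J] by blast
  have opp: "\<not> (path_image ?c - {p v1, p v2} \<subseteq> X \<and> path_image ?d - {p v3, p v4} \<subseteq> X)"
    "\<not> (path_image ?c - {p v1, p v2} \<subseteq> X \<and> path_image ?d' - {p v3, p v4} \<subseteq> X)"
    "\<not> (path_image ?c' - {p v1, p v2} \<subseteq> X \<and> path_image ?d - {p v3, p v4} \<subseteq> X)"
    if "X \<in> {inside J, outside J}" for X
  proof -
    define W where "W = (if X = inside J then outside J else inside J)"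
    have W: "(X, W) \<in> {(inside J, outside J), (outside J, inside J)}"
      using that unfolding W_def by simp auto
    show "\<not> (path_image ?c - {p v1, p v2} \<subseteq> X \<and> path_image ?d - {p v3, p v4} \<subseteq> X)"
      using cross [OF arcs(1,2) start(1-4) disj(1) W] by blast
    show "\<not> (path_image ?c - {p v1, p v2} \<subseteq> X \<and> path_image ?d' - {p v3, p v4} \<subseteq> X)"
      using cross [OF arcs(1,4) start(1,2,7,8) disj(2) W] by blast
    show "\<not> (path_image ?c' - {p v1, p v2} \<subseteq> X \<and> path_image ?d - {p v3, p v4} \<subseteq> X)"
      using cross [OF arcs(3,2) start(5,6,3,4) disj(3) W] by blast
  qed
  \<comment> \<open>If \<open>?c\<close> lies in \<open>X\<close>, then \<open>?d\<close> lies on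
    the other side. \<open>?c'\<close> cannot join \<open>?d\<close> there, so it lies in
    \<open>X\<close>, and \<open>?d'\<close> follows it into \<open>X\<close>, which already
    contains \<open>?c\<close>.\<close>
  show False
    using c
  proof
    assume "path_image ?c - {p v1, p v2} \<subseteq> inside J"
    then show False
      using c' d same_side opp [of "inside J"] opp [of "outside J"] by blast
  next
    assume "path_image ?c - {p v1, p v2} \<subseteq> outside J"
    then show False
      using c' d same_side opp [of "inside J"] opp [of "outside J"] by blast
  qed
qed

section \<open>From the sphere to the plane\<close>

lemma interior_punctured_arc_image_empty:
  fixes \<gamma> :: "real \<Rightarrow> 'a::euclidean_space" and f :: "'a \<Rightarrow> complex"
  assumes "arc \<gamma>" and hom: "homeomorphism S (UNIV :: complex set) f g"
  shows "interior (f ` (path_image \<gamma> \<inter> S)) = {}"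
proof (rule ccontr)
  let ?U = "interior (f ` (path_image \<gamma> \<inter> S))"
  assume "?U \<noteq> {}"
  obtain k where k: "homeomorphism {0..1} (path_image \<gamma>) \<gamma> k"
    using homeomorphism_arc [OF \<open>arc \<gamma>\<close>] .
  have gf: "g (f x) = x" if "x \<in> S" for x
    using hom that by (simp add: homeomorphism_def)
  have sub: "g ` ?U \<subseteq> path_image \<gamma>"
    using interior_subset gf by fastforce
  \<comment> \<open>\<open>k\<close> inverts the parametrization of the arc, so
    \<open>k \<circ> g\<close> would embed a non-empty open set of the plane into the real
    line.\<close>
  have "continuous_on ?U (k \<circ> g)"
    using hom k sub unfolding homeomorphism_def
    by (intro continuous_on_compose) (blast intro: continuous_on_subset)+
  moreover have "inj_on k (path_image \<gamma>)" "inj g"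
    using hom k by (metis homeomorphism_def inj_on_inverseI UNIV_I)+
  then have "inj_on (k \<circ> g) ?U"
    using sub by (intro comp_inj_on) (blast intro: inj_on_subset)+
  ultimately have "DIM(complex) \<le> DIM(real)"
    using \<open>?U \<noteq> {}\<close> by (intro invariance_of_dimension [of ?U]) auto
  then show False by simp
qed

lemma interior_UN_closed_empty:
  assumes "finite I" "\<And>i. i \<in> I \<Longrightarrow> closed (C i)" "\<And>i. i \<in> I \<Longrightarrow> interior (C i) = {}"
  shows "interior (\<Union>i\<in>I. C i) = {}"
  using assms
proof (induction I)
  case (insert i I)
  then show ?case
    using interior_closed_Un_empty_interior [of "C i" "\<Union>i\<in>I. C i"] by auto
qed simp

lemma punctured_sphere_homeomorphic_plane:
  fixes b :: "real^3"
  assumes "b \<in> sphere 0 1"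
  obtains f g where "homeomorphism (sphere 0 1 - {b}) (UNIV :: complex set) f g"
proof -
  have "(sphere 0 1 - {b}) homeomorphic (UNIV :: complex set)"
    by (rule homeomorphic_punctured_sphere_affine) (use assms in \<open>auto simp: aff_dim_UNIV\<close>)
  with that show thesis
    by (auto simp: homeomorphic_def)
qed

text \<open>Arcs have empty interior in the sphere by invariance of dimension, so finitely many of them leave
  a point from which to project.\<close>

lemma planar_graph_plane_embedding:
  assumes "planar_graph V E" "finite E" "\<Union>E \<subseteq> V"
  obtains p \<gamma> where "plane_embedding E p \<gamma>"
proof -
  obtain p \<gamma> where emb: "sphere_embedding V E p \<gamma>"
    using assms unfolding planar_graph_def by blast
  let ?S = "sphere 0 1 :: (real^3) set"
  \<comment> \<open>The point \<open>b\<close> may lie on some arcs. Projecting from it only serves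
    to find a point \<open>o'\<close> off all arcs, which becomes the actual centre.\<close>
  obtain b where b: "b \<in> ?S" 
    using vector_choose_size [of 1] by auto
  obtain f g where fg: "homeomorphism (?S - {b}) (UNIV :: complex set) f g"
    using punctured_sphere_homeomorphic_plane [OF b] .
  have arc: "arc (\<gamma> e)" "path_image (\<gamma> e) \<subseteq> ?S" if "e \<in> E" for e
    using emb that unfolding sphere_embedding_def by auto
  have "closed (f ` (path_image (\<gamma> e) \<inter> (?S - {b})))" if "e \<in> E" for e
  proof -
    have "closedin (top_of_set (?S - {b})) (path_image (\<gamma> e) \<inter> (?S - {b}))"
      using arc [OF that] closed_arc_image closedin_closed by blast
    then have "closedin (top_of_set UNIV) (f ` (path_image (\<gamma> e) \<inter> (?S - {b})))"
      using homeomorphism_imp_closed_map [OF fg] by blast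
    then show ?thesis by simp
  qed
  then have "interior (\<Union>e\<in>E. f ` (path_image (\<gamma> e) \<inter> (?S - {b}))) = {}"
    using interior_punctured_arc_image_empty [OF arc(1) fg] assms(2)
    by (intro interior_UN_closed_empty) auto
  then obtain w where w: "w \<notin> (\<Union>e\<in>E. f ` (path_image (\<gamma> e) \<inter> (?S - {b})))"
    by (metis UNIV_eq_I empty_not_UNIV interior_UNIV)
  define o' where "o' = g w"
  have o': "o' \<in> ?S - {b}" "f o' = w"
    using fg unfolding o'_def homeomorphism_def by blast+
  have "o' \<notin> path_image (\<gamma> e)" if "e \<in> E" for e
    using w o' that by blast
  then have arc': "path_image (\<gamma> e) \<subseteq> ?S - {o'}" if "e \<in> E" for e
    using arc that by blast
  obtain h k where hk: "homeomorphism (?S - {o'}) (UNIV :: complex set) h k"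
    using punctured_sphere_homeomorphic_plane o' by blast
  have h: "inj_on h (?S - {o'})" "continuous_on (?S - {o'}) h"
    using hk by (metis homeomorphism_def inj_on_inverseI)+
  have ends: "p ` e = {pathstart (\<gamma> e), pathfinish (\<gamma> e)}" if "e \<in> E" for e
    using emb that unfolding sphere_embedding_def by simp
  have pS: "p ` (\<Union>E) \<subseteq> ?S - {o'}"
  proof (intro image_subsetI)
    fix x assume "x \<in> \<Union>E"
    then obtain e where e: "e \<in> E" "x \<in> e"
      by blast
    then have "p x \<in> {pathstart (\<gamma> e), pathfinish (\<gamma> e)}"
      using ends by blast
    then have "p x \<in> path_image (\<gamma> e)"
      using pathstart_in_path_image [of "\<gamma> e"] pathfinish_in_path_image [of "\<gamma> e"] by auto
    then show "p x \<in> ?S - {o'}"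
      using arc' [OF e(1)] by blast
  qed
  have "inj_on (h \<circ> p) (\<Union>E)"
  proof (rule comp_inj_on)
    show "inj_on p (\<Union>E)"
      by (rule inj_on_subset [OF _ assms(3)]) (use emb in \<open>simp add: sphere_embedding_def\<close>)
    show "inj_on h (p ` \<Union>E)"
      using h(1) pS by (rule inj_on_subset)
  qed
  moreover have "arc (h \<circ> \<gamma> e)" if e: "e \<in> E" for e
  proof -
    have "path (h \<circ> \<gamma> e)"
      using arc [OF e] by (intro path_continuous_image continuous_on_subset [OF h(2) arc' [OF e]] arc_imp_path)
    moreover have "inj_on (h \<circ> \<gamma> e) {0..1}"
      using arc(1) [OF e] arc' [OF e] inj_on_subset [OF h(1)]
      by (intro comp_inj_on) (auto simp: arc_def path_image_def)
    ultimately show ?thesis by (simp add: arc_def)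
  qed
  moreover have "path_image (h \<circ> \<gamma> e) \<inter> path_image (h \<circ> \<gamma> e') = (h \<circ> p) ` (e \<inter> e')"
    if "e \<in> E" "e' \<in> E" "e \<noteq> e'" for e e'
  proof -
    have "path_image (\<gamma> e) \<inter> path_image (\<gamma> e') = p ` (e \<inter> e')"
      using emb that unfolding sphere_embedding_def by simp
    then show ?thesis
      using inj_on_image_Int [OF h(1) arc' [OF that(1)] arc' [OF that(2)]]
      by (simp add: path_image_compose image_comp)
  qed
  moreover have "{pathstart (h \<circ> \<gamma> e), pathfinish (h \<circ> \<gamma> e)} = (h \<circ> p) ` e" if "e \<in> E" for e
    by (simp only: pathstart_compose pathfinish_compose image_comp [symmetric] ends [OF that] image_insert image_empty)
  ultimately have "plane_embedding E (h \<circ> p) (\<lambda>e. h \<circ> \<gamma> e)"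
    unfolding plane_embedding_def by blast
  then show thesis by (rule that)
qed

theorem planar_graph_no_K5:
  assumes "planar_graph V E" "finite E" "\<Union>E \<subseteq> V"
    and "card K = 5" and "\<And>x y. x \<in> K \<Longrightarrow> y \<in> K \<Longrightarrow> x \<noteq> y \<Longrightarrow> {x, y} \<in> E"
  shows False
  using planar_graph_plane_embedding [OF assms(1-3)] plane_embedding_no_K5 [OF _ assms(4,5)] by metis

section \<open>Centralizers and conjugation\<close>

definition centralizer :: "('g, 'b) monoid_scheme \<Rightarrow> 'g set \<Rightarrow> 'g set" where
  "centralizer G S = {g \<in> carrier G. \<forall>s \<in> S. g \<otimes>\<^bsub>G\<^esub> s = s \<otimes>\<^bsub>G\<^esub> g}"

definition conj_by :: "('g, 'b) monoid_scheme \<Rightarrow> 'g \<Rightarrow> 'g \<Rightarrow> 'g" where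
  "conj_by G g a = g \<otimes>\<^bsub>G\<^esub> a \<otimes>\<^bsub>G\<^esub> inv\<^bsub>G\<^esub> g"

lemma group_center_eq_centralizer: "group_center G = centralizer G (carrier G)"
  by (simp add: group_center_def centralizer_def)

lemma centralizer_antimono: "S \<subseteq> T \<Longrightarrow> centralizer G T \<subseteq> centralizer G S"
  by (auto simp: centralizer_def)

lemma centralizer_subset_carrier: "centralizer G S \<subseteq> carrier G"
  by (auto simp: centralizer_def)

context group
begin

lemma subgroup_centralizer:
  assumes "S \<subseteq> carrier G"
  shows "subgroup (centralizer G S) G"
proof (rule subgroupI)
  show "centralizer G S \<subseteq> carrier G" by (rule centralizer_subset_carrier)
  have "\<one> \<in> centralizer G S"
    using assms by (auto simp: centralizer_def)
  then show "centralizer G S \<noteq> {}" by blast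
next
  fix a assume a: "a \<in> centralizer G S"
  have "inv a \<otimes> s = s \<otimes> inv a" if "s \<in> S" for s
  proof -
    have [simp]: "a \<in> carrier G" "s \<in> carrier G" "a \<otimes> s = s \<otimes> a"
      using a that assms by (auto simp: centralizer_def)
    have "inv a \<otimes> s = inv a \<otimes> (s \<otimes> a) \<otimes> inv a"
      by (simp add: m_assoc)
    also have "\<dots> = inv a \<otimes> (a \<otimes> s) \<otimes> inv a"
      by simp
    also have "\<dots> = s \<otimes> inv a"
      by (simp add: m_assoc [symmetric] del: \<open>a \<otimes> s = s \<otimes> a\<close>)
    finally show ?thesis .
  qed
  with a show "inv a \<in> centralizer G S"
    by (auto simp: centralizer_def)
next
  fix a b assume "a \<in> centralizer G S" "b \<in> centralizer G S"
  moreover have "a \<otimes> b \<otimes> s = s \<otimes> (a \<otimes> b)"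
    if "a \<in> carrier G" "b \<in> carrier G" "s \<in> carrier G" "a \<otimes> s = s \<otimes> a" "b \<otimes> s = s \<otimes> b" for s
    using that by (metis m_assoc)
  ultimately show "a \<otimes> b \<in> centralizer G S"
    using assms by (auto simp: centralizer_def subset_iff)
qed

lemma subset_bicentralizer: "S \<subseteq> carrier G \<Longrightarrow> S \<subseteq> centralizer G (centralizer G S)"
  by (auto simp: centralizer_def)

text \<open>A commuting set lies in its own centralizer, and centralizers reverse inclusions. It
  follows that \<open>centralizer G (centralizer G S)\<close> is abelian.\<close>

lemma bicentralizer_subset_centralizer:
  assumes "S \<subseteq> carrier G" "\<And>x y. x \<in> S \<Longrightarrow> y \<in> S \<Longrightarrow> x \<otimes> y = y \<otimes> x"
  shows "centralizer G (centralizer G S) \<subseteq> centralizer G S"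
  using assms by (intro centralizer_antimono) (auto simp: centralizer_def)

lemma center_subset_centralizer: "S \<subseteq> carrier G \<Longrightarrow> group_center G \<subseteq> centralizer G S"
  by (auto simp: group_center_eq_centralizer intro: centralizer_antimono [THEN subsetD])

lemma card_subgroup_dvd_card_subgroup:
  assumes "subgroup H G" "subgroup K G" "H \<subseteq> K"
  shows "card H dvd card K"
proof -
  interpret K: group "G\<lparr>carrier := K\<rparr>"
    using assms(2) subgroup_imp_group by blast
  have "subgroup H (G\<lparr>carrier := K\<rparr>)"
    using assms subgroup_incl by blast
  from K.lagrange [OF this] have "card (rcosets\<^bsub>G\<lparr>carrier := K\<rparr>\<^esub> H) * card H = card K"
    by (simp add: Coset.order_def)
  then show ?thesis
    by (metis dvd_triv_right)
qed

section \<open>Conjugation and conjugacy classes\<close>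

lemma conj_by_closed [simp]: "g \<in> carrier G \<Longrightarrow> a \<in> carrier G \<Longrightarrow> conj_by G g a \<in> carrier G"
  by (simp add: conj_by_def)

lemma conj_by_one [simp]: "a \<in> carrier G \<Longrightarrow> conj_by G \<one> a = a"
  by (simp add: conj_by_def)

lemma conj_by_conj_by:
  "\<lbrakk>g \<in> carrier G; h \<in> carrier G; a \<in> carrier G\<rbrakk> \<Longrightarrow> conj_by G g (conj_by G h a) = conj_by G (g \<otimes> h) a"
  by (simp add: conj_by_def m_assoc inv_mult_group)

lemma conj_by_mult:
  assumes [simp]: "g \<in> carrier G" "a \<in> carrier G" "b \<in> carrier G"
  shows "conj_by G g (a \<otimes> b) = conj_by G g a \<otimes> conj_by G g b"
proof -
  have "conj_by G g a \<otimes> conj_by G g b = g \<otimes> a \<otimes> (inv g \<otimes> g) \<otimes> b \<otimes> inv g"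
    unfolding conj_by_def by (simp only: m_assoc assms inv_closed m_closed)
  then show ?thesis
    by (simp add: conj_by_def m_assoc)
qed

lemma conj_by_eq_iff [simp]:
  assumes "g \<in> carrier G" "a \<in> carrier G" "b \<in> carrier G"
  shows "conj_by G g a = conj_by G g b \<longleftrightarrow> a = b"
  using assms by (simp add: conj_by_def)

lemma conj_by_inv: "\<lbrakk>g \<in> carrier G; a \<in> carrier G\<rbrakk> \<Longrightarrow> conj_by G g (inv a) = inv (conj_by G g a)"
  by (simp add: conj_by_def inv_mult_group m_assoc)

lemma conj_by_fixed_iff:
  assumes [simp]: "g \<in> carrier G" "a \<in> carrier G"
  shows "conj_by G g a = a \<longleftrightarrow> g \<otimes> a = a \<otimes> g"
proof -
  have "conj_by G g a = a \<longleftrightarrow> g \<otimes> a \<otimes> inv g \<otimes> g = a \<otimes> g"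
    unfolding conj_by_def by (subst right_cancel) simp_all
  also have "g \<otimes> a \<otimes> inv g \<otimes> g = g \<otimes> a"
    by (simp add: m_assoc)
  finally show ?thesis .
qed

lemma conj_by_image_centralizer:
  assumes g [simp]: "g \<in> carrier G" and a [simp]: "a \<in> carrier G"
  shows "conj_by G g ` centralizer G {a} = centralizer G {conj_by G g a}"
proof -
  have sub: "conj_by G g ` centralizer G {a} \<subseteq> centralizer G {conj_by G g a}"
    if [simp]: "g \<in> carrier G" "a \<in> carrier G" for g a
    by (auto simp: centralizer_def conj_by_mult [symmetric])
  have "x \<in> conj_by G g ` centralizer G {a}" if x: "x \<in> centralizer G {conj_by G g a}" for x
  proof -
    have "x \<in> carrier G"
      using x by (simp add: centralizer_def)
    moreover have "conj_by G (inv g) x \<in> centralizer G {conj_by G (inv g) (conj_by G g a)}"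
      using sub [of "inv g" "conj_by G g a"] x by auto
    ultimately show ?thesis
      by (intro image_eqI [of _ _ "conj_by G (inv g) x"]) (simp_all add: conj_by_conj_by)
  qed
  then show ?thesis
    using sub [OF g a] by blast
qed

lemma card_centralizer_conj_by:
  assumes "g \<in> carrier G" "a \<in> carrier G"
  shows "card (centralizer G {conj_by G g a}) = card (centralizer G {a})"
  unfolding conj_by_image_centralizer [OF assms, symmetric]
  using assms by (intro card_image) (auto simp: inj_on_def centralizer_def)

text \<open>\<open>A\<close> is a union of conjugacy classes, and by the orbit-stabilizer theorem
  \<open>k\<close> times the size of each class is the order of \<open>G\<close>. The induction
  removes one class at a time.\<close>

lemma order_dvd_conjugation_invariant:
  assumes "finite (carrier G)" and "A \<subseteq> carrier G"
    and "\<And>g a. g \<in> carrier G \<Longrightarrow> a \<in> A \<Longrightarrow> conj_by G g a \<in> A"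
    and "\<And>a. a \<in> A \<Longrightarrow> card (centralizer G {a}) = k"
  shows "Coset.order G dvd k * card A"
proof -
  have "finite A"
    using assms finite_subset by blast
  then show ?thesis
    using assms(2-)
  proof (induction A rule: finite_psubset_induct)
    case (psubset A)
    show ?case
    proof (cases "A = {}")
      case False
      then obtain a where a: "a \<in> A" "a \<in> carrier G"
        using psubset by blast
      let ?\<phi> = "\<lambda>g. \<lambda>h\<in>carrier G. g \<otimes> h \<otimes> inv g"
      interpret group_action G "carrier G" ?\<phi>
        by (rule action_by_conjugation)
      define O' where "O' = (\<lambda>g. conj_by G g a) ` carrier G"
      have "orbit G ?\<phi> a = O'"
        using a by (auto simp: orbit_def O'_def conj_by_def)
      moreover have "stabilizer G ?\<phi> a = centralizer G {a}"
        using a conj_by_fixed_iff by (auto simp: stabilizer_def centralizer_def conj_by_def)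
      ultimately have "Coset.order G = k * card O'"
        using orbit_stabilizer_theorem [OF a(2)] psubset.prems(3) [OF a(1)] by (simp add: mult.commute)
      moreover have "Coset.order G dvd k * card (A - O')"
      proof (rule psubset.IH)
        have "conj_by G \<one> a \<in> O'"
          unfolding O'_def by blast
        then show "A - O' \<subset> A"
          using a by auto
        show "conj_by G g b \<in> A - O'" if g: "g \<in> carrier G" and b: "b \<in> A - O'" for g b
        proof -
          have bG: "b \<in> carrier G"
            using b psubset.prems by blast
          have "conj_by G g b \<notin> O'"
          proof
            assume "conj_by G g b \<in> O'"
            then obtain h where h: "h \<in> carrier G" "conj_by G g b = conj_by G h a"
              unfolding O'_def by blast
            then have "b = conj_by G (inv g \<otimes> h) a"
              using g a bG by (metis conj_by_conj_by conj_by_one inv_closed l_inv)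
            then show False
              using b g h unfolding O'_def by blast
          qed
          then show ?thesis
            using psubset.prems(2) g b by blast
        qed
      qed (use psubset.prems in auto)
      moreover have "card A = card O' + card (A - O')"
      proof -
        have "O' \<subseteq> A"
          using psubset.prems(2) a unfolding O'_def by blast
        then show ?thesis
          using \<open>finite A\<close> by (metis card_Un_disjoint Diff_disjoint Un_Diff_cancel finite_Diff finite_subset sup.absorb2)
      qed
      ultimately show ?thesis
        by (simp add: distrib_left)
    qed simp
  qed
qed

text \<open>The action gives an injective homomorphism into \<open>sym_group n\<close>, which is
  onto because the orders agree.\<close>

lemma iso_sym_group_if_faithful_action:
  assumes "finite T" "card T = n" and order: "Coset.order G = fact n"
    and act: "\<And>g t. g \<in> carrier G \<Longrightarrow> t \<in> T \<Longrightarrow> f g t \<in> T"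
    and mult: "\<And>g h t. g \<in> carrier G \<Longrightarrow> h \<in> carrier G \<Longrightarrow> t \<in> T \<Longrightarrow> f (g \<otimes> h) t = f g (f h t)"
    and one: "\<And>t. t \<in> T \<Longrightarrow> f \<one> t = t"
    and faithful: "\<And>g. g \<in> carrier G \<Longrightarrow> (\<And>t. t \<in> T \<Longrightarrow> f g t = t) \<Longrightarrow> g = \<one>"
  shows "G \<cong> sym_group n"
proof -
  obtain b where b: "bij_betw b {1..n} T"
    using assms(1,2) by (metis ex_bij_betw_nat_finite_1)
  define b' where "b' = inv_into {1..n} b"
  have b': "b' t \<in> {1..n}" "b (b' t) = t" if "t \<in> T" for t
    using b that unfolding b'_def by (auto simp: bij_betw_def inv_into_into f_inv_into_f)
  have b'b: "b' (b i) = i" if "i \<in> {1..n}" for i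
    using b that unfolding b'_def by (auto simp: bij_betw_def)
  have bT: "b i \<in> T" if "i \<in> {1..n}" for i
    using b that by (auto simp: bij_betw_def)
  \<comment> \<open>Elements of \<open>sym_group n\<close> permute all natural numbers and fix those
    outside \<open>{1..n}\<close>; hence the default value \<open>i\<close>.\<close>
  define \<phi> where "\<phi> g i = (if i \<in> {1..n} then b' (f g (b i)) else i)" for g i
  have \<phi>in: "\<phi> g i \<in> {1..n}" if "g \<in> carrier G" "i \<in> {1..n}" for g i
    using that b' act bT by (simp add: \<phi>_def del: atLeastAtMost_iff)
  have \<phi>mult: "\<phi> (g \<otimes> h) = \<phi> g \<circ> \<phi> h" if "g \<in> carrier G" "h \<in> carrier G" for g h
  proof
    fix i
    show "\<phi> (g \<otimes> h) i = (\<phi> g \<circ> \<phi> h) i"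
      using that b' act bT by (auto simp: \<phi>_def mult simp del: atLeastAtMost_iff)
  qed
  have \<phi>one: "\<phi> \<one> = id"
    using b'b bT one by (auto simp: \<phi>_def fun_eq_iff)
  have perm: "\<phi> g permutes {1..n}" if g: "g \<in> carrier G" for g
  proof -
    have "\<phi> (inv g) \<circ> \<phi> g = id" "\<phi> g \<circ> \<phi> (inv g) = id"
      using \<phi>mult [of "inv g" g] \<phi>mult [of g "inv g"] g \<phi>one by auto
    then have "bij (\<phi> g)"
      using o_bij by blast
    then show ?thesis
      unfolding permutes_def bij_iff by (simp add: \<phi>_def)
  qed
  interpret S: group "sym_group n"
    by (rule sym_group_is_group)
  have hom: "\<phi> \<in> hom G (sym_group n)"
    using perm \<phi>mult by (auto simp: hom_def sym_group_def)
  then interpret group_hom G "sym_group n" \<phi>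
    by unfold_locales
  have "inj_on \<phi> (carrier G)"
  proof (rule inj_onI [OF _])
    fix g h assume gh: "g \<in> carrier G" "h \<in> carrier G" "\<phi> g = \<phi> h"
    have "f g t = f h t" if "t \<in> T" for t
    proof -
      have "b' (f g t) = b' (f h t)"
        using fun_cong [OF gh(3), of "b' t"] b' [OF that] by (simp add: \<phi>_def del: atLeastAtMost_iff)
      then show ?thesis
        using b'(2) act gh that by metis
    qed
    then have "f (inv h \<otimes> g) t = t" if "t \<in> T" for t
      using gh that mult [of "inv h" g t] mult [of "inv h" h t] one by simp
    then have "inv h \<otimes> g = \<one>"
      using faithful gh by simp
    then have "inv g = inv h"
      using gh(1,2) by (intro inv_equality) simp_all
    then show "g = h"
      using gh(1,2) by (rule inj_onD [OF inv_inj])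
  qed
  moreover have "card (carrier (sym_group n)) = card (carrier G)"
    using order sym_group_card_carrier by (simp add: Coset.order_def)
  moreover have "finite (carrier (sym_group n))"
    by (simp add: sym_group_def finite_permutations)
  moreover have "\<phi> ` carrier G \<subseteq> carrier (sym_group n)"
    using hom by (auto simp: hom_def)
  ultimately have "bij_betw \<phi> (carrier G) (carrier (sym_group n))"
    unfolding bij_betw_def by (metis card_image card_subset_eq)
  then show ?thesis
    unfolding is_iso_def iso_def using hom by blast
qed

section \<open>Recognizing the symmetric group by centralizers of order three\<close>

lemma centralizer_singleton_commute:
  "\<lbrakk>a \<in> carrier G; b \<in> carrier G\<rbrakk> \<Longrightarrow> a \<in> centralizer G {b} \<longleftrightarrow> b \<in> centralizer G {a}"
  by (auto simp: centralizer_def)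

lemma centralizer_inv:
  assumes "a \<in> carrier G"
  shows "centralizer G {inv a} = centralizer G {a}"
proof -
  have "x \<in> centralizer G {inv a}" if "x \<in> centralizer G {a}" "a \<in> carrier G" for x a
  proof -
    have x: "x \<in> carrier G"
      using that by (simp add: centralizer_def)
    then have "inv a \<in> centralizer G {x}"
      using that centralizer_singleton_commute subgroup.m_inv_closed [OF subgroup_centralizer [of "{x}"]] by blast
    then show ?thesis
      using x that centralizer_singleton_commute by blast
  qed
  from this [of _ a] this [of _ "inv a"] show ?thesis
    using assms by auto
qed

text \<open>The identity is excluded because its centralizer is the whole group. If \<open>t\<close>
  were an involution, a third element \<open>c\<close> of its centralizer would bring in
  \<open>t \<otimes> c\<close> as a fourth.\<close>

lemma centralizer_eq_if_card_3:
  assumes t: "t \<in> carrier G" and card: "card (centralizer G {t}) = 3" "card (carrier G) \<noteq> 3"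
  shows "centralizer G {t} = {\<one>, t, inv t}" "t \<noteq> \<one>" "inv t \<noteq> t"
proof -
  let ?C = "centralizer G {t}"
  have C: "subgroup ?C G"
    using t by (intro subgroup_centralizer) simp
  have fin: "finite ?C"
    using card card_ge_0_finite by force
  have tC: "t \<in> ?C"
    using t by (simp add: centralizer_def)
  show t1: "t \<noteq> \<one>"
  proof
    assume "t = \<one>"
    then have "?C = carrier G"
      by (auto simp: centralizer_def)
    with card show False by simp
  qed
  show tt: "inv t \<noteq> t"
  proof
    assume inv: "inv t = t"
    have "card {\<one>, t} < card ?C"
      using card t1 by simp
    then obtain c where c: "c \<in> ?C" "c \<noteq> \<one>" "c \<noteq> t"
      by (metis card_mono finite.intros insertCI leD subsetI)
    have cG: "c \<in> carrier G"
      using c by (simp add: centralizer_def)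
    have "t \<otimes> c \<noteq> \<one>" "t \<otimes> c \<noteq> t" "t \<otimes> c \<noteq> c"
      using c t cG t1 inv by (metis inv_equality inv_inv, simp, simp)
    then have "card {\<one>, t, c, t \<otimes> c} = 4"
      using c t1 by (auto simp: card_insert_if)
    moreover have "{\<one>, t, c, t \<otimes> c} \<subseteq> ?C"
      using C c tC by (auto simp: subgroup.one_closed subgroup.m_closed)
    ultimately have "4 \<le> card ?C"
      using card_mono [OF fin] by metis
    then show False
      using card by simp
  qed
  have "{\<one>, t, inv t} \<subseteq> ?C"
    using C tC by (auto simp: subgroup.one_closed subgroup.m_inv_closed)
  moreover have "inv t \<noteq> \<one>"
    using t t1 by (simp add: inv_eq_1_iff)
  then have "card {\<one>, t, inv t} = 3"
    using t1 tt by (auto simp: card_insert_if)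
  ultimately show "?C = {\<one>, t, inv t}"
    using card_subset_eq [OF fin] card by metis
qed

text \<open>\<open>G\<close> acts by conjugation on the set \<open>T\<close> of centralizers of order \<open>3\<close>. A non-trivial \<open>g\<close> in the kernel
  must invert every element of order \<open>3\<close>, and so must its conjugates; then \<open>g\<close> times a conjugate of
  \<open>g\<close> centralizes all these elements and is trivial, which makes \<open>g\<close> central.\<close>

lemma iso_sym_group_4:
  assumes N: "Coset.order G = 24" and center: "group_center G = {\<one>}"
    and n3: "card {t \<in> carrier G. card (centralizer G {t}) = 3} = 8"
  shows "G \<cong> sym_group 4"
proof -
  define C where "C t = centralizer G {t}" for t
  define T3 where "T3 = {t \<in> carrier G. card (C t) = 3}"
  have cT3: "card T3 = 8"
    using n3 by (simp add: T3_def C_def)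
  then have finT3: "finite T3"
    using card_ge_0_finite by force
  have T3: "t \<in> carrier G" "C t = {\<one>, t, inv t}" "t \<noteq> \<one>" "inv t \<noteq> t" if "t \<in> T3" for t
    using that centralizer_eq_if_card_3 [of t] N by (auto simp: T3_def C_def Coset.order_def)
  have C_inv: "C (inv t) = C t" if "t \<in> T3" for t
    using centralizer_inv T3 that by (simp add: C_def)
  have C_eq: "s \<in> T3" "C s = C t" if t: "t \<in> T3" and s: "s \<in> C t" "s \<noteq> \<one>" for s t
  proof -
    have "s \<in> {t, inv t}"
      using s T3(2) [OF t] by auto
    then show eq: "C s = C t"
      using C_inv [OF t] by auto
    have "s \<in> carrier G"
      using s by (simp add: C_def centralizer_def)
    then show "s \<in> T3"
      using eq t by (simp add: T3_def)
  qed
  have C_comm: "s \<in> C t \<longleftrightarrow> t \<in> C s" if "s \<in> carrier G" "t \<in> carrier G" for s t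
    using centralizer_singleton_commute that by (simp add: C_def)
  have C_conj: "s \<in> C t \<longleftrightarrow> conj_by G s t = t" if "s \<in> carrier G" "t \<in> carrier G" for s t
    using conj_by_fixed_iff that by (simp add: C_def centralizer_def)
  define T where "T = C ` T3"
  \<comment> \<open>Exactly \<open>t\<close> and \<open>inv t\<close> have the centralizer
    \<open>C t\<close>, so the eight elements of \<open>T3\<close> yield four subgroups.\<close>
  have "card T3 = (\<Sum>X\<in>T. card {t \<in> T3. C t = X})"
    using sum.image_gen [OF finT3, of "\<lambda>_. 1 :: nat" C] by (simp add: T_def)
  also have "\<dots> = (\<Sum>X\<in>T. 2)"
  proof (rule sum.cong [OF refl])
    fix X assume "X \<in> T"
    then obtain t where t: "t \<in> T3" "X = C t"
      by (auto simp: T_def)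
    have "{s \<in> T3. C s = X} = {t, inv t}"
    proof (intro equalityI subsetI)
      fix s assume "s \<in> {s \<in> T3. C s = X}"
      then have "s \<in> C t" "s \<noteq> \<one>"
        using T3(2,3) [of s] t by auto
      then show "s \<in> {t, inv t}"
        using T3 t by auto
    next
      fix s assume "s \<in> {t, inv t}"
      then show "s \<in> {s \<in> T3. C s = X}"
        using C_eq [OF t(1)] T3 [OF t(1)] t by auto
    qed
    then show "card {s \<in> T3. C s = X} = 2"
      using T3(4) [OF t(1)] by (simp add: card_insert_if)
  qed
  finally have cT: "card T = 4"
    using cT3 by simp
  have conj_T3: "conj_by G g t \<in> T3" if "g \<in> carrier G" "t \<in> T3" for g t
    using that(2) card_centralizer_conj_by [OF that(1) T3(1) [OF that(2)]] that(1)
    by (simp add: T3_def C_def)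
  have conj_C: "conj_by G g ` C t = C (conj_by G g t)" if "g \<in> carrier G" "t \<in> T3" for g t
    using that T3(1) conj_by_image_centralizer by (simp add: C_def)
  have TG: "X \<subseteq> carrier G" if "X \<in> T" for X
    using that by (auto simp: T_def C_def centralizer_def)
  have other: "\<exists>t'\<in>T3. t' \<notin> C t" if t: "t \<in> T3" for t
  proof (rule ccontr)
    assume "\<not> ?thesis"
    then have "T3 \<subseteq> C t" by blast
    then have "8 \<le> card (C t)"
      using cT3 T3(2) [OF t] card_mono [of "C t" T3] by simp
    then show False
      using t by (simp add: T3_def)
  qed
  have sq: "t \<otimes> t \<noteq> \<one>" if "t \<in> T3" for t
    using T3 [OF that] inv_equality by blast
  have C_mult: "a \<otimes> b \<in> C t" if "a \<in> C t" "b \<in> C t" "t \<in> carrier G" for a b t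
    using that subgroup.m_closed [OF subgroup_centralizer [of "{t}"]] by (simp add: C_def)
  \<comment> \<open>Otherwise \<open>g\<close> centralizes \<open>t\<close>, and \<open>g\<close>
    and \<open>g \<otimes> g\<close> both have centralizer \<open>C t\<close>. For \<open>t'\<close>
    outside \<open>C t\<close>, \<open>g\<close> must then invert \<open>t'\<close>, so
    \<open>g \<otimes> g\<close> fixes \<open>t'\<close>, which puts \<open>t'\<close> into
    \<open>C t\<close>.\<close>
  have inverts: "conj_by G g t = inv t"
    if g: "g \<in> carrier G" "g \<noteq> \<one>" and K: "\<And>t. t \<in> T3 \<Longrightarrow> conj_by G g t \<in> {t, inv t}" and t: "t \<in> T3" for g t
  proof (rule ccontr)
    assume "conj_by G g t \<noteq> inv t"
    then have "g \<in> C t"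
      using K t C_conj T3(1) g by blast
    then have gT3: "g \<in> T3" "C g = C t" and "g \<otimes> g \<in> C t"
      using C_eq g C_mult t T3(1) by blast+
    then have gg: "C (g \<otimes> g) = C t"
      using C_eq(2) [OF t] sq by blast
    obtain t' where t': "t' \<in> T3" "t' \<notin> C t"
      using other t by blast
    note [simp] = T3(1) [OF t'(1)] g(1)
    have "conj_by G g t' \<noteq> t'"
      using C_conj [of g t'] C_comm [of g t'] gT3 t' by auto
    then have "conj_by G g t' = inv t'"
      using K t' by blast
    then have "conj_by G (g \<otimes> g) t' = t'"
      using conj_by_conj_by [of g g t'] conj_by_inv [of g t'] by simp
    then have "t' \<in> C (g \<otimes> g)"
      using C_conj [of "g \<otimes> g" t'] C_comm [of "g \<otimes> g" t'] by simp
    then show False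
      using gg t' by simp
  qed
  show ?thesis
  proof (rule iso_sym_group_if_faithful_action [where T = T and f = "\<lambda>g X. conj_by G g ` X"])
    show "finite T"
      using finT3 by (simp add: T_def)
    show "card T = 4" by (rule cT)
    show "Coset.order G = fact 4"
      using N by (simp add: fact_numeral)
    show "conj_by G g ` X \<in> T" if "g \<in> carrier G" "X \<in> T" for g X
      using that conj_C conj_T3 by (auto simp: T_def)
    show "conj_by G (g \<otimes> h) ` X = conj_by G g ` conj_by G h ` X"
      if "g \<in> carrier G" "h \<in> carrier G" "X \<in> T" for g h X
      unfolding image_image using that TG [OF that(3)]
      by (intro image_cong) (auto simp: conj_by_conj_by subset_iff)
    show "conj_by G \<one> ` X = X" if "X \<in> T" for X
    proof -
      have "conj_by G \<one> ` X = id ` X"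
        using TG [OF that] by (intro image_cong) auto
      then show ?thesis by simp
    qed
    show "g = \<one>" if g: "g \<in> carrier G" and fixed: "\<And>X. X \<in> T \<Longrightarrow> conj_by G g ` X = X" for g
    proof (rule ccontr)
      assume g1: "g \<noteq> \<one>"
      have K: "conj_by G g t \<in> {t, inv t}" if t: "t \<in> T3" for t
      proof -
        have "C (conj_by G g t) = C t"
          using fixed [of "C t"] conj_C g t by (simp add: T_def)
        then show ?thesis
          using T3 [OF conj_T3 [OF g t]] T3(2) [OF t] by auto
      qed
      obtain t where t: "t \<in> T3"
        using cT3 by force
      obtain t' where t': "t' \<in> T3" "t' \<notin> C t"
        using other t by blast
      have prod: "g \<otimes> conj_by G h g = \<one>" if h: "h \<in> carrier G" for h
      proof (rule ccontr)
        assume ne: "g \<otimes> conj_by G h g \<noteq> \<one>"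
        have Kh: "conj_by G (conj_by G h g) s \<in> {s, inv s}" if s: "s \<in> T3" for s
        proof -
          have s': "conj_by G (inv h) s \<in> T3"
            using conj_T3 h s by simp
          have [simp]: "s \<in> carrier G"
            using T3(1) s .
          have "conj_by G (conj_by G h g) s = conj_by G h (conj_by G g (conj_by G (inv h) s))"
            using h g by (simp add: conj_by_conj_by) (simp add: conj_by_def m_assoc)
          moreover have "conj_by G h (conj_by G (inv h) s) = s"
            using h by (simp add: conj_by_conj_by)
          ultimately show ?thesis
            using K [OF s'] h T3(1) [OF s'] by (auto simp: conj_by_inv)
        qed
        have ne': "conj_by G h g \<noteq> \<one>"
          using h g g1 conj_by_eq_iff [of h g \<one>] by (simp add: conj_by_def)
        have "g \<otimes> conj_by G h g \<in> C s" if s: "s \<in> T3" for s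
        proof -
          have "conj_by G g (conj_by G (conj_by G h g) s) = s"
            using inverts [OF g g1 K s] inverts [OF _ ne' Kh s] h g T3(1) [OF s]
            by (simp add: conj_by_inv)
          then show ?thesis
            using C_conj h g T3(1) [OF s] by (simp add: conj_by_conj_by)
        qed
        \<comment> \<open>A non-trivial element common to \<open>C t\<close> and \<open>C t'\<close>
          has both subgroups as its centralizer.\<close>
        from this [OF t] this [OF t'(1)] have "C t = C t'"
          using C_eq(2) ne t t'(1) by metis
        then show False
          using t' T3(2) by auto
      qed
      \<comment> \<open>The choice \<open>h = \<one>\<close> makes \<open>g\<close> its own inverse;
        then \<open>prod\<close> says that each conjugate of \<open>g\<close> equals
        \<open>g\<close>.\<close>
      have "g \<otimes> g = \<one>"
        using prod [of \<one>] g by simp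
      then have "inv g = g"
        using g by (intro inv_equality) simp_all
      have "conj_by G h g = g" if h: "h \<in> carrier G" for h
      proof -
        have "inv (conj_by G h g) = g"
          using prod [OF h] g h by (intro inv_equality) simp_all
        then have "inv (conj_by G h g) = inv g"
          using \<open>inv g = g\<close> by simp
        then show ?thesis
          by (rule inj_onD [OF inv_inj]) (use g h in simp_all)
      qed
      then have "g \<in> group_center G"
        using g conj_by_fixed_iff by (auto simp: group_center_def)
      then show False
        using center g1 by simp
    qed
  qed
qed

end

section \<open>Groups without five commuting non-central elements\<close>

text \<open>Here \<open>n\<^sub>k\<close> is the number of elements with a centralizer of order \<open>k\<close>, so \<open>k n\<^sub>k / N\<close> is the number
  of their conjugacy classes.\<close>

lemma class_equation_solutions:
  fixes N :: nat
  assumes sum: "N = 1 + n2 + n3 + n4 + n5 + n8"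
    and dvd: "N dvd 2 * n2" "N dvd 3 * n3" "N dvd 4 * n4" "N dvd 5 * n5" "N dvd 8 * n8"
    and pos: "n4 > 0" "n8 > 0" and N: "8 dvd N" "8 < N"
  shows "N = 24 \<and> n3 = 8 \<or> N = 40 \<and> n4 = 10 \<and> n8 = 5"
proof -
  obtain a2 a3 a4 a5 a8 where a: "2 * n2 = N * a2" "3 * n3 = N * a3" "4 * n4 = N * a4" "5 * n5 = N * a5" "8 * n8 = N * a8"
    using dvd by (metis dvd_def)
  have a48: "a4 \<ge> 1" "a8 \<ge> 1"
    using a pos by (auto simp: Suc_le_eq intro: gr0I)
  \<comment> \<open>The number of classes with centralizer order \<open>k\<close> is
    \<open>ak\<close>. As 120 is the least common multiple of 2, 3, 4, 5 and 8, multiplying the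
    class equation by 120 clears the denominators and gives
    \<open>N * (120 - D) = 120\<close>.\<close>
  define D where "D = 60 * a2 + 40 * a3 + 30 * a4 + 24 * a5 + 15 * a8"
  have "120 * N = 120 + 60 * (2 * n2) + 40 * (3 * n3) + 30 * (4 * n4) + 24 * (5 * n5) + 15 * (8 * n8)"
    using sum by simp
  also have "\<dots> = 120 + N * D"
    unfolding a D_def by (simp add: algebra_simps)
  finally have D: "N * 120 = 120 + N * D"
    by simp
  then have ND: "N * (120 - D) = 120"
    by (simp add: diff_mult_distrib2)
  obtain m where m: "N = 8 * m"
    using N by (auto simp: dvd_def)
  then have "m * (120 - D) = 15" and "m \<ge> 2"
    using ND N by auto
  then have "m dvd 15"
    by (metis dvd_triv_left)
  then have "m \<le> 15"
    by (rule dvd_imp_le) simp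
  with \<open>m \<ge> 2\<close> have "m \<in> {2, 3, 4, 5, 6, 7, 8, 9, 10, 11, 12, 13, 14, 15}"
    by simp presburger
  with \<open>m dvd 15\<close> have "m \<in> {3, 5, 15}"
    by auto
  then consider "m = 3" "D = 115" | "m = 5" "D = 117" | "m = 15" "D = 119"
    using \<open>m * (120 - D) = 15\<close> by auto
  then show ?thesis
  proof cases
    case 1
    have "a3 = 1"
      using 1(2) a48 unfolding D_def by presburger
    then show ?thesis
      using a m 1 by simp
  next
    case 2
    \<comment> \<open>All coefficients of \<open>D\<close> but 24 are multiples of 5, so
      \<open>117 + a5 = 5 * K\<close> gives \<open>a5\<close> modulo 5. With \<open>a5 = 3\<close>,
      the mandatory \<open>a4 = a8 = 1\<close> already exhausts 117.\<close>
    define K where "K = 12 * a2 + 8 * a3 + 6 * a4 + 5 * a5 + 3 * a8"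
    have "a5 \<le> 3"
      using 2(2) a48 unfolding D_def by linarith
    moreover have "117 + a5 = 5 * K"
      using 2(2) unfolding D_def K_def distrib_left by linarith
    ultimately have "a5 = 3"
      by presburger
    then have "a4 = 1 \<and> a8 = 1"
      using 2(2) a48 unfolding D_def by linarith
    then show ?thesis
      using a m 2 by simp
  next
    case 3
    have False
      using 3(2) a48 unfolding D_def by presburger
    then show ?thesis ..
  qed
qed

section \<open>Orders of centralizers and bicentralizers\<close>

locale few_commuting_group = group G for G (structure) +
  assumes finite_carrier: "finite (carrier G)"
    and card_commuting_le: "\<And>K. K \<subseteq> carrier G - group_center G \<Longrightarrow>
      (\<And>x y. x \<in> K \<Longrightarrow> y \<in> K \<Longrightarrow> x \<otimes> y = y \<otimes> x) \<Longrightarrow> card K \<le> 4"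
begin

abbreviation C where "C S \<equiv> centralizer G S"

lemma finite_centralizer [simp]: "finite (C S)"
  by (rule finite_subset [OF centralizer_subset_carrier finite_carrier])

lemma card_centralizer_pos: "S \<subseteq> carrier G \<Longrightarrow> card (C S) > 0"
  using subgroup.one_closed [OF subgroup_centralizer] by (auto simp: card_gt_0_iff)

text \<open>The bicentralizer of a commuting set is abelian, so its non-central elements form a
  commuting set.\<close>

lemma card_bicentralizer_le:
  assumes "S \<subseteq> carrier G" "\<And>x y. x \<in> S \<Longrightarrow> y \<in> S \<Longrightarrow> x \<otimes> y = y \<otimes> x"
  shows "card (C (C S)) \<le> 4 + card (group_center G)"
proof -
  have comm: "x \<otimes> y = y \<otimes> x" if "x \<in> C (C S)" "y \<in> C (C S)" for x y
    using that bicentralizer_subset_centralizer [OF assms] unfolding centralizer_def by blast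
  have "card (C (C S) - group_center G) \<le> 4"
    using centralizer_subset_carrier [of G "C S"] comm by (intro card_commuting_le) auto
  moreover have "group_center G \<subseteq> C (C S)"
    by (intro center_subset_centralizer centralizer_subset_carrier)
  ultimately show ?thesis
    by (simp add: card_Diff_subset finite_subset [OF _ finite_centralizer])
qed

text \<open>The chain \<open>group_center G\<close>, \<open>C (C {x})\<close>,
  \<open>C (C {x, y})\<close> is strict, as \<open>x\<close> and then \<open>y\<close> is new. Each
  order is at least twice the one before, and the last is at most 4 plus the first; so
  \<open>4 * z \<le> 4 + z\<close>, which forces \<open>z = 1\<close>.\<close>

lemma nonabelian_centralizer:
  assumes x: "x \<in> carrier G" "x \<notin> group_center G" and y: "y \<in> C {x}" "y \<notin> C (C {x})"
  shows "card (group_center G) = 1" "card (C (C {x})) = 2" "card (C (C {x, y})) = 4"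
proof -
  have yG: "y \<in> carrier G" and xy: "x \<otimes> y = y \<otimes> x"
    using y by (auto simp: centralizer_def)
  let ?Z = "group_center G"
  have sub: "subgroup (C (C {x})) G" "subgroup (C (C {x, y})) G"
    by (intro subgroup_centralizer centralizer_subset_carrier)+
  have Z: "subgroup ?Z G"
    unfolding group_center_eq_centralizer by (rule subgroup_centralizer) simp
  have ZB: "?Z \<subset> C (C {x})"
    using center_subset_centralizer [OF centralizer_subset_carrier] x subset_bicentralizer [of "{x}"] by blast
  have BB: "C (C {x}) \<subset> C (C {x, y})"
    using centralizer_antimono [OF centralizer_antimono, of "{x}" "{x, y}"] y(2)
      subset_bicentralizer [of "{x, y}"] x yG by blast
  have "card (C (C {x, y})) \<le> 4 + card ?Z"
    using x yG xy by (intro card_bicentralizer_le) auto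
  moreover have "card ?Z dvd card (C (C {x}))" "card (C (C {x})) dvd card (C (C {x, y}))"
    using ZB BB Z sub by (blast intro: card_subgroup_dvd_card_subgroup)+
  moreover have "card ?Z < card (C (C {x}))" "card (C (C {x})) < card (C (C {x, y}))"
    using ZB BB by (simp_all add: psubset_card_mono)
  moreover have "card ?Z > 0"
    unfolding group_center_eq_centralizer by (rule card_centralizer_pos) simp
  ultimately have *: "card ?Z = 1 \<and> card (C (C {x})) = 2 \<and> card (C (C {x, y})) = 4"
  proof -
    define z b a where "z = card ?Z" and "b = card (C (C {x}))" and "a = card (C (C {x, y}))"
    assume "card (C (C {x, y})) \<le> 4 + card ?Z" "card ?Z dvd card (C (C {x}))"
      "card (C (C {x})) dvd card (C (C {x, y}))" "card ?Z < card (C (C {x}))"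
      "card (C (C {x})) < card (C (C {x, y}))" "card ?Z > 0"
    then have h: "a \<le> 4 + z" "z dvd b" "b dvd a" "z < b" "b < a" "z > 0"
      by (simp_all add: z_def b_def a_def)
    obtain k l where kl: "b = z * k" "a = b * l"
      using h by (auto simp: dvd_def)
    have "k \<ge> 2" "l \<ge> 2"
      using h kl by (auto simp: Suc_le_eq not_le numeral_2_eq_2 intro: ccontr)
    then have "2 * z \<le> b" "2 * b \<le> a"
      using kl by (simp_all add: mult.commute [of _ k] mult.commute [of _ l])
    then have "z = 1" "b = 2"
      using h by linarith+
    then have "a = 4"
      using h kl \<open>2 * b \<le> a\<close> by presburger
    then show ?thesis
      using \<open>z = 1\<close> \<open>b = 2\<close> by (simp add: z_def b_def a_def)
  qed
  then show "card ?Z = 1" "card (C (C {x})) = 2" "card (C (C {x, y})) = 4"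
    by blast+
qed

text \<open>\<open>C {x, y}\<close> coincides with its own centralizer: for \<open>w\<close> in it,
  the bicentralizer of \<open>{x, y, w}\<close> has order a positive multiple of 4 and at most 5, so
  it is no larger than \<open>C (C {x, y})\<close>, yet it contains \<open>w\<close>.\<close>

lemma card_centralizer_pair:
  assumes x: "x \<in> carrier G" "x \<notin> group_center G" and y: "y \<in> C {x}" "y \<notin> C (C {x})"
  shows "card (C {x, y}) = 4"
proof -
  have yG: "y \<in> carrier G" and xy: "x \<otimes> y = y \<otimes> x"
    using y by (auto simp: centralizer_def)
  have xyG: "{x, y} \<subseteq> carrier G"
    using x yG by blast
  note c = nonabelian_centralizer [OF x y]
  have "C {x, y} \<subseteq> C (C {x, y})"
  proof
    fix w assume w: "w \<in> C {x, y}"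
    then have wG: "{x, y, w} \<subseteq> carrier G"
      using xyG by (auto simp: centralizer_def)
    have sub: "C (C {x, y}) \<subseteq> C (C {x, y, w})"
      by (intro centralizer_antimono) auto
    have "card (C (C {x, y, w})) \<le> 4 + card (group_center G)"
      using w xy wG by (intro card_bicentralizer_le) (auto simp: centralizer_def)
    moreover have "4 dvd card (C (C {x, y, w}))"
      unfolding c(3) [symmetric] using sub
      by (intro card_subgroup_dvd_card_subgroup subgroup_centralizer centralizer_subset_carrier)
    moreover have "card (C (C {x, y, w})) > 0"
      by (intro card_centralizer_pos centralizer_subset_carrier)
    ultimately have "card (C (C {x, y, w})) = 4"
      using c(1) by presburger
    then have "C (C {x, y}) = C (C {x, y, w})"
      using c(3) sub by (intro card_subset_eq) auto
    then show "w \<in> C (C {x, y})"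
      using subset_bicentralizer [OF wG] by blast
  qed
  moreover have "C (C {x, y}) \<subseteq> C {x, y}"
    using xyG xy by (intro bicentralizer_subset_centralizer) auto
  ultimately show ?thesis
    using c by auto
qed

text \<open>\<open>C (C {x})\<close> is the center of \<open>C {x}\<close> and has order 2; any
  other \<open>a\<close> in \<open>C {x}\<close> has the centralizer \<open>C {x, a}\<close> of
  order 4 there. Counting conjugates, the order \<open>c\<close> of \<open>C {x}\<close> divides
  \<open>4 * (c - 2)\<close>, hence divides 8, and it exceeds 4.\<close>

lemma card_nonabelian_centralizer:
  assumes x: "x \<in> carrier G" "x \<notin> group_center G" and nonab: "\<not> C {x} \<subseteq> C (C {x})"
  shows "card (C {x}) = 8"
proof -
  obtain y where y: "y \<in> C {x}" "y \<notin> C (C {x})"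
    using nonab by blast
  let ?H = "G\<lparr>carrier := C {x}\<rparr>"
  let ?A = "C {x} - C (C {x})"
  have sx: "subgroup (C {x}) G"
    using x by (intro subgroup_centralizer) simp
  interpret H: group ?H
    using sx subgroup_imp_group by blast
  have conj: "conj_by ?H g a = conj_by G g a" if "g \<in> C {x}" for g a
    using m_inv_consistent [OF sx that] by (simp add: conj_by_def)
  have pair: "centralizer ?H {a} = C {x, a}" for a
    by (auto simp: centralizer_def)
  have "Coset.order ?H dvd 4 * card ?A"
  proof (rule H.order_dvd_conjugation_invariant)
    show "conj_by ?H g a \<in> ?A" if g: "g \<in> carrier ?H" and a: "a \<in> ?A" for g a
    proof -
      have [simp]: "g \<in> carrier G" "a \<in> carrier G"
        using g a by (auto simp: centralizer_def)
      have gC: "g \<in> C {x}" and "conj_by ?H g a \<in> C {x}"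
        using H.conj_by_closed [OF g, of a] g a by auto
      \<comment> \<open>A conjugate in \<open>C (C {x})\<close> would commute with \<open>g\<close>,
        hence equal \<open>a\<close>, which is not in there.\<close>
      moreover have "conj_by G g a \<notin> C (C {x})"
      proof
        assume "conj_by G g a \<in> C (C {x})"
        then have "g \<otimes> conj_by G g a = conj_by G g a \<otimes> g"
          using gC by (auto simp: centralizer_def)
        then have "g \<otimes> a = a \<otimes> g"
          using conj_by_fixed_iff [of g "conj_by G g a"] conj_by_fixed_iff [of g a]
          by simp
        then have "conj_by G g a = a"
          using conj_by_fixed_iff by simp
        with \<open>conj_by G g a \<in> C (C {x})\<close> a show False by simp
      qed
      ultimately show ?thesis
        by (simp add: conj)
    qed
    show "card (centralizer ?H {a}) = 4" if "a \<in> ?A" for a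
      using that card_centralizer_pair [OF x] by (simp add: pair)
  qed (use finite_centralizer in auto)
  moreover have "card ?A = card (C {x}) - 2"
  proof -
    have "C (C {x}) \<subseteq> C {x}"
      using x by (intro bicentralizer_subset_centralizer) auto
    then show ?thesis
      using nonabelian_centralizer(2) [OF x y] by (simp add: card_Diff_subset)
  qed
  ultimately have dvd: "card (C {x}) dvd 4 * (card (C {x}) - 2)"
    by (simp add: Coset.order_def)
  have "C {x, y} \<noteq> C {x}"
  proof
    assume eq: "C {x, y} = C {x}"
    have "y \<otimes> g = g \<otimes> y" if "g \<in> C {x}" for g
    proof -
      have "g \<in> C {x, y}"
        using eq that by simp
      then show ?thesis
        by (simp add: centralizer_def)
    qed
    then show False
      using y by (simp add: centralizer_def [of G "C {x}"]) (simp add: centralizer_def)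
  qed
  then have "C {x, y} \<subset> C {x}"
    using centralizer_antimono [of "{x}" "{x, y}"] by blast
  then have gt: "card (C {x}) > 4"
    using card_centralizer_pair [OF x y] by (metis finite_centralizer psubset_card_mono)
  have "card (C {x}) dvd 4 * card (C {x}) - 4 * (card (C {x}) - 2)"
    using dvd by (intro dvd_diff_nat) simp
  then have "card (C {x}) dvd 8"
    using gt by (simp add: diff_mult_distrib2)
  moreover from this have "card (C {x}) \<le> 8"
    by (rule dvd_imp_le) simp
  with gt have "card (C {x}) = 5 \<or> card (C {x}) = 6 \<or> card (C {x}) = 7 \<or> card (C {x}) = 8"
    by presburger
  ultimately show ?thesis by auto
qed

section \<open>Class equation and the possible centralizer orders\<close>

lemma order_dvd_card_centralizer:
  "Coset.order G dvd k * card {g \<in> carrier G. card (C {g}) = k}"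
  using card_centralizer_conj_by finite_carrier
  by (intro order_dvd_conjugation_invariant) auto

lemma trivial_center_if_nonabelian_centralizer:
  assumes "x \<in> carrier G" "x \<notin> group_center G" "\<not> C {x} \<subseteq> C (C {x})"
  shows "group_center G = {\<one>}"
proof -
  obtain y where "y \<in> C {x}" "y \<notin> C (C {x})"
    using assms by blast
  then have "card (group_center G) = 1"
    using nonabelian_centralizer assms by blast
  moreover have "\<one> \<in> group_center G"
    by (simp add: group_center_def)
  ultimately show ?thesis
    by (metis card_1_singletonE singletonD)
qed

text \<open>An abelian centralizer lies in the bicentralizer of \<open>g\<close>, which has at most
  4 + 1 elements, and contains \<open>\<one>\<close> and \<open>g\<close>.\<close>

lemma card_centralizer_cases:
  assumes center: "group_center G = {\<one>}" and g: "g \<in> carrier G" "g \<noteq> \<one>"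
  shows "card (C {g}) \<in> {2, 3, 4, 5} \<or> card (C {g}) = 8 \<and> \<not> C {g} \<subseteq> C (C {g})"
proof (cases "C {g} \<subseteq> C (C {g})")
  case True
  then have "card (C {g}) \<le> card (C (C {g}))"
    by (simp add: card_mono)
  also have "\<dots> \<le> 5"
    using card_bicentralizer_le [of "{g}"] g center by simp
  finally have "card (C {g}) \<le> 5" .
  moreover have "card {\<one>, g} \<le> card (C {g})"
    using g by (intro card_mono finite_centralizer) (auto simp: centralizer_def)
  then have "2 \<le> card (C {g})"
    using g by simp
  ultimately show ?thesis by auto
next
  case False
  then show ?thesis
    using card_nonabelian_centralizer g center by simp
qed

context
  assumes center: "group_center G = {\<one>}"
begin

text \<open>Order 8 is too large for an abelian centralizer. So \<open>C (C {x})\<close> has order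
  2, and every \<open>w\<close> in \<open>C {x}\<close> other than \<open>\<one>\<close> and
  \<open>x\<close> lies outside it.\<close>

lemma centralizer_card_8:
  assumes x: "x \<in> carrier G" and card: "card (C {x}) = 8" and one: "x \<noteq> \<one>"
  shows "C (C {x}) = {\<one>, x}" "x \<otimes> x = \<one>" "\<not> C {x} \<subseteq> C (C {x})"
    and "\<And>w. w \<in> C {x} \<Longrightarrow> w \<noteq> \<one> \<Longrightarrow> w \<noteq> x \<Longrightarrow> card (C {x, w}) = 4"
proof -
  show nonab: "\<not> C {x} \<subseteq> C (C {x})"
    using card_centralizer_cases [OF center x one] card by auto
  have xZ: "x \<notin> group_center G"
    using center one by simp
  obtain y where y: "y \<in> C {x}" "y \<notin> C (C {x})"
    using nonab by blast
  have sub: "subgroup (C (C {x})) G"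
    by (intro subgroup_centralizer centralizer_subset_carrier)
  have xB: "x \<in> C (C {x})"
    using subset_bicentralizer [of "{x}"] x by simp
  have "{\<one>, x} \<subseteq> C (C {x})"
    using xB subgroup.one_closed [OF sub] by simp
  then show B: "C (C {x}) = {\<one>, x}"
    using nonabelian_centralizer(2) [OF x xZ y] one
    by (intro card_subset_eq [symmetric]) simp_all
  then have "x \<otimes> x \<in> {\<one>, x}"
    using subgroup.m_closed [OF sub xB xB] by simp
  then show "x \<otimes> x = \<one>"
    using x one by auto
  show "card (C {x, w}) = 4" if "w \<in> C {x}" "w \<noteq> \<one>" "w \<noteq> x" for w
    using card_centralizer_pair [OF x xZ that(1)] B that by simp
qed

text \<open>By Lagrange the order 4 of \<open>C {x, w}\<close> divides that of
  \<open>C {w}\<close>.\<close>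

lemma card_centralizer_in_nonabelian_centralizer:
  assumes x: "x \<in> carrier G" "card (C {x}) = 8" "x \<noteq> \<one>"
    and w: "w \<in> C {x}" "w \<noteq> \<one>" "w \<noteq> x"
  shows "card (C {w}) = 4 \<or> card (C {w}) = 8"
proof -
  have wG: "w \<in> carrier G"
    using w by (simp add: centralizer_def)
  have "card (C {x, w}) dvd card (C {w})"
    using x wG by (intro card_subgroup_dvd_card_subgroup subgroup_centralizer centralizer_antimono) auto
  then have "4 dvd card (C {w})"
    using centralizer_card_8(4) [OF x w] by simp
  then show ?thesis
    using card_centralizer_cases [OF center wG w(2)] by auto
qed

text \<open>Count the commuting pairs in \<open>X \<times> Y\<close>: every element of \<open>Y\<close> has order \<open>4\<close> and commutes with at most
  one involution in \<open>X\<close>, which forces all \<open>5\<close> elements of \<open>X\<close> to commute with each other.\<close>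

lemma not_order_40:
  assumes Y: "card {g \<in> carrier G. card (C {g}) = 4} = 10" (is "card ?Y = 10")
    and X: "card {g \<in> carrier G. card (C {g}) = 8} = 5" (is "card ?X = 5")
    and N: "Coset.order G = 40"
    and w: "w \<in> carrier G" "card (C {w}) = 4" "w \<otimes> w \<noteq> \<one>"
  shows False
proof -
  have fin: "finite ?X" "finite ?Y"
    using finite_carrier by simp_all
  have C1: "C {\<one>} = carrier G"
    by (auto simp: centralizer_def)
  have X1: "x \<noteq> \<one>" if "x \<in> ?X" for x
    using that C1 N by (auto simp: Coset.order_def)
  \<comment> \<open>\<open>?Y'\<close> is closed under conjugation and contains \<open>w\<close>, so
    its size is a positive multiple of 40 / 4 = 10, the size of \<open>?Y\<close>. Hence no element
    of \<open>?Y\<close> is an involution.\<close>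
  let ?Y' = "{g \<in> ?Y. g \<otimes> g \<noteq> \<one>}"
  have "Coset.order G dvd 4 * card ?Y'"
  proof (rule order_dvd_conjugation_invariant [OF finite_carrier])
    show "conj_by G g a \<in> ?Y'" if "g \<in> carrier G" "a \<in> ?Y'" for g a
    proof -
      have a: "a \<in> carrier G"
        using that by simp
      have "conj_by G g a \<otimes> conj_by G g a = conj_by G g (a \<otimes> a)"
        using that by (simp add: conj_by_mult)
      moreover have "conj_by G g (a \<otimes> a) \<noteq> conj_by G g \<one>"
        using that by (subst conj_by_eq_iff) auto
      moreover have "conj_by G g \<one> = \<one>"
        using that by (simp add: conj_by_def)
      ultimately show ?thesis
        using that card_centralizer_conj_by [OF that(1) a] by simp
    qed
  qed auto
  moreover have "card ?Y' > 0"
    using w finite_carrier by (auto simp: card_gt_0_iff)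
  ultimately have "10 \<le> card ?Y'"
    using N by (auto dest: dvd_imp_le)
  then have "?Y' = ?Y"
    using Y fin by (intro card_seteq) auto
  then have Y2: "y \<otimes> y \<noteq> \<one>" if "y \<in> ?Y" for y
    using that by blast
  \<comment> \<open>Two involutions together with \<open>\<one>\<close>, \<open>y\<close> and
    \<open>inv y\<close> would be five elements of a group of order 4.\<close>
  have CY: "card (C {y} \<inter> ?X) \<le> 1" if y: "y \<in> ?Y" for y
  proof -
    have yG: "y \<in> carrier G"
      using y by simp
    have sy: "subgroup (C {y}) G"
      using yG by (intro subgroup_centralizer) simp
    have inv_y: "inv y \<noteq> y" "inv y \<noteq> \<one>" "y \<noteq> \<one>"
      using Y2 [OF y] yG r_inv [OF yG] by (fastforce, auto simp: inv_eq_1_iff)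
    have "x = x'" if x: "x \<in> C {y} \<inter> ?X" "x' \<in> C {y} \<inter> ?X" for x x'
    proof (rule ccontr)
      assume ne: "x \<noteq> x'"
      have new: "z \<notin> {\<one>, y, inv y}" if z: "z \<in> ?X" for z
      proof -
        have "z \<in> carrier G" "z \<otimes> z = \<one>" "z \<noteq> \<one>"
          using z X1 centralizer_card_8(2) by blast+
        moreover from this have "inv z = z"
          by (metis inv_equality)
        ultimately show ?thesis
          using Y2 [OF y] yG by auto
      qed
      have "{\<one>, y, inv y, x, x'} \<subseteq> C {y}"
        using x sy yG by (auto simp: subgroup.one_closed subgroup.m_inv_closed centralizer_def)
      then have "card {\<one>, y, inv y, x, x'} \<le> 4"
        using y card_mono [OF finite_centralizer, of "{\<one>, y, inv y, x, x'}" "{y}"] by simp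
      moreover have "card {\<one>, y, inv y, x, x'} = 5"
        using ne inv_y inv_y(2) [symmetric] new [of x] new [of x'] x yG by (auto simp: card_insert_if)
      ultimately show False by simp
    qed
    then show ?thesis
      by (metis (no_types, lifting) card_le_Suc0_iff_eq fin(1) finite_Int One_nat_def)
  qed
  have CX: "card (C {x} \<inter> ?X) + card (C {x} \<inter> ?Y) = 7" if x: "x \<in> ?X" for x
  proof -
    have xG: "x \<in> carrier G" "card (C {x}) = 8" "x \<noteq> \<one>"
      using x X1 by auto
    have "C {x} - {\<one>} = (C {x} \<inter> ?X) \<union> (C {x} \<inter> ?Y)"
    proof (intro equalityI subsetI)
      fix w assume w: "w \<in> C {x} - {\<one>}"
      then have "w \<in> carrier G"
        by (simp add: centralizer_def)
      moreover have "card (C {w}) = 4 \<or> card (C {w}) = 8"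
        using card_centralizer_in_nonabelian_centralizer [OF xG, of w] w xG by (cases "w = x") auto
      ultimately show "w \<in> (C {x} \<inter> ?X) \<union> (C {x} \<inter> ?Y)"
        using w by auto
    next
      fix w assume "w \<in> (C {x} \<inter> ?X) \<union> (C {x} \<inter> ?Y)"
      then show "w \<in> C {x} - {\<one>}"
        using C1 N by (auto simp: Coset.order_def)
    qed
    moreover have "card (C {x} - {\<one>}) = 7"
    proof -
      have "\<one> \<in> C {x}"
        using xG by (simp add: centralizer_def)
      then show ?thesis
        using xG by (simp add: card_Diff_singleton)
    qed
    moreover have "(C {x} \<inter> ?X) \<inter> (C {x} \<inter> ?Y) = {}"
      by auto
    ultimately show ?thesis
      using card_Un_disjoint [of "C {x} \<inter> ?X" "C {x} \<inter> ?Y"] by simp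
  qed
  have ind: "card (C {x} \<inter> A) = (\<Sum>y\<in>A. if y \<in> C {x} then 1 else 0)" if "finite A" for x A
    using that by (simp add: sum.If_cases Int_commute)
  have "(\<Sum>x\<in>?X. card (C {x} \<inter> ?Y)) = (\<Sum>x\<in>?X. \<Sum>y\<in>?Y. if y \<in> C {x} then 1 else 0)"
    using fin by (simp only: ind)
  also have "\<dots> = (\<Sum>y\<in>?Y. \<Sum>x\<in>?X. if y \<in> C {x} then 1 else 0)"
    by (rule sum.swap)
  also have "\<dots> = (\<Sum>y\<in>?Y. \<Sum>x\<in>?X. if x \<in> C {y} then 1 else 0)"
    by (intro sum.cong refl) (simp add: centralizer_singleton_commute)
  also have "\<dots> = (\<Sum>y\<in>?Y. card (C {y} \<inter> ?X))"
    using fin by (simp only: ind)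
  also have "\<dots> \<le> (\<Sum>y\<in>?Y. 1)"
    using CY by (intro sum_mono)
  finally have "(\<Sum>x\<in>?X. card (C {x} \<inter> ?Y)) \<le> 10"
    using Y by simp
  moreover have "(\<Sum>x\<in>?X. card (C {x} \<inter> ?X)) + (\<Sum>x\<in>?X. card (C {x} \<inter> ?Y)) = 35"
    using CX X by (simp add: sum.distrib [symmetric])
  \<comment> \<open>At least 35 - 10 = 25 commuting pairs lie in \<open>?X\<close> times
    \<open>?X\<close>, which has only 5 times 5 pairs.\<close>
  ultimately have sum: "25 \<le> (\<Sum>x\<in>?X. card (C {x} \<inter> ?X))"
    by simp
  have le: "card (C {x} \<inter> ?X) \<le> 5" for x
    using X card_mono [OF fin(1), of "C {x} \<inter> ?X"] by simp
  have "?X \<subseteq> C {x}" if x: "x \<in> ?X" for x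
  proof -
    have "(\<Sum>x\<in>?X. card (C {x} \<inter> ?X)) = card (C {x} \<inter> ?X) + (\<Sum>x\<in>?X - {x}. card (C {x} \<inter> ?X))"
      using fin(1) x by (rule sum.remove)
    also have "(\<Sum>x\<in>?X - {x}. card (C {x} \<inter> ?X)) \<le> (\<Sum>x\<in>?X - {x}. 5)"
      by (intro sum_mono le)
    also have "\<dots> = 20"
      using X x by (simp add: card_Diff_singleton)
    finally have "5 \<le> card (C {x} \<inter> ?X)"
      using sum by simp
    then have "C {x} \<inter> ?X = ?X"
      using X fin(1) by (intro card_seteq) auto
    then show ?thesis by blast
  qed
  then have "card ?X \<le> 4"
    using center X1 by (intro card_commuting_le) (auto simp: centralizer_def)
  with X show False by simp
qed

end

theorem iso_sym_group_4_if_nonabelian_centralizer: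
  assumes x: "x \<in> carrier G" "x \<notin> group_center G" and nonab: "\<not> C {x} \<subseteq> C (C {x})"
  shows "G \<cong> sym_group 4"
proof -
  have center: "group_center G = {\<one>}"
    using trivial_center_if_nonabelian_centralizer assms by blast
  have x1: "x \<noteq> \<one>"
    using x center by blast
  have c8: "card (C {x}) = 8"
    using card_nonabelian_centralizer assms by blast
  note x8 = centralizer_card_8 [OF center x(1) c8 x1]
  let ?N = "Coset.order G"
  define n where "n k = card {g \<in> carrier G. card (C {g}) = k}" for k
  have "8 dvd ?N"
    unfolding c8 [symmetric] Coset.order_def using x
    by (intro card_subgroup_dvd_card_subgroup subgroup_centralizer subgroup_self centralizer_subset_carrier) auto
  moreover have "C {x} \<noteq> carrier G"
  proof
    assume eq: "C {x} = carrier G"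
    have "x \<otimes> g = g \<otimes> x" if "g \<in> carrier G" for g
    proof -
      have "g \<in> C {x}"
        using eq that by simp
      then show ?thesis
        by (simp add: centralizer_def)
    qed
    then show False
      using x by (simp add: group_center_def)
  qed
  then have "C {x} \<subset> carrier G"
    using centralizer_subset_carrier [of G "{x}"] by blast
  then have N8: "8 < ?N"
    unfolding c8 [symmetric] Coset.order_def using finite_carrier by (rule psubset_card_mono [rotated])
  moreover have "?N = 1 + n 2 + n 3 + n 4 + n 5 + n 8"
  proof -
    have C1: "C {\<one>} = carrier G"
      by (auto simp: centralizer_def)
    have "carrier G = {\<one>} \<union> (\<Union>k\<in>{2, 3, 4, 5, 8}. {g \<in> carrier G. card (C {g}) = k})"
      using card_centralizer_cases [OF center] by auto
    then have "?N = card ({\<one>} \<union> (\<Union>k\<in>{2, 3, 4, 5, 8}. {g \<in> carrier G. card (C {g}) = k}))"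
      by (simp only: Coset.order_def)
    \<comment> \<open>The identity counts separately: its centralizer has order \<open>?N\<close>,
      more than 8.\<close>
    also have "\<dots> = 1 + card (\<Union>k\<in>{2, 3, 4, 5, 8}. {g \<in> carrier G. card (C {g}) = k})"
      using N8 C1 finite_carrier by (subst card_Un_disjoint) (auto simp: Coset.order_def)
    also have "card (\<Union>k\<in>{2, 3, 4, 5, 8}. {g \<in> carrier G. card (C {g}) = k}) = (\<Sum>k\<in>{2, 3, 4, 5, 8}. n k)"
      unfolding n_def using finite_carrier by (intro card_UN_disjoint) auto
    finally show ?thesis by simp
  qed
  moreover have "?N dvd k * n k" for k
    unfolding n_def by (rule order_dvd_card_centralizer)
  \<comment> \<open>A group in which all squares are trivial is abelian, and \<open>C {x}\<close> is
    not.\<close>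
  moreover obtain w where w: "w \<in> C {x}" "w \<otimes> w \<noteq> \<one>"
  proof (rule ccontr)
    assume "\<not> thesis"
    then have sq: "w \<otimes> w = \<one>" if "w \<in> C {x}" for w
      using that \<open>\<And>w. \<lbrakk>w \<in> C {x}; w \<otimes> w \<noteq> \<one>\<rbrakk> \<Longrightarrow> thesis\<close> by blast
    have sx: "subgroup (C {x}) G"
      using x by (intro subgroup_centralizer) simp
    have inv: "inv w = w" if "w \<in> C {x}" for w
      using sq [OF that] that by (intro inv_equality) (auto simp: centralizer_def)
    have "a \<otimes> b = b \<otimes> a" if ab: "a \<in> C {x}" "b \<in> C {x}" for a b
    proof -
      have "a \<in> carrier G" "b \<in> carrier G"
        using ab by (auto simp: centralizer_def)
      then have "inv (a \<otimes> b) = b \<otimes> a"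
        using inv ab by (simp add: inv_mult_group)
      then show ?thesis
        using inv [of "a \<otimes> b"] subgroup.m_closed [OF sx ab] by simp
    qed
    then have "C {x} \<subseteq> C (C {x})"
      using centralizer_subset_carrier [of G "{x}"] by (auto simp: centralizer_def [of G "C {x}"])
    with nonab show False by blast
  qed
  have wG: "w \<in> carrier G"
    using w by (simp add: centralizer_def)
  have w1: "w \<noteq> \<one>" "w \<noteq> x"
    using w x8(2) by auto
  \<comment> \<open>A non-trivial element with centralizer of order 8 is an involution.\<close>
  then have "card (C {w}) \<noteq> 8"
    using centralizer_card_8(2) [OF center wG] w by blast
  then have w4: "card (C {w}) = 4"
    using card_centralizer_in_nonabelian_centralizer [OF center x(1) c8 x1 w(1) w1] by blast
  have "n 4 > 0" "n 8 > 0"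
    unfolding n_def card_gt_0_iff using wG w4 x(1) c8 finite_carrier by auto
  ultimately have "?N = 24 \<and> n 3 = 8 \<or> ?N = 40 \<and> n 4 = 10 \<and> n 8 = 5"
    by (intro class_equation_solutions [where ?n2.0 = "n 2" and ?n5.0 = "n 5"]) simp_all
  then show ?thesis
    using iso_sym_group_4 [OF _ center] not_order_40 [OF center _ _ _ wG w4 w(2)]
    unfolding n_def by blast
qed

end

section \<open>Spectra of the commuting graph\<close>

unbundle no vec_syntax and no inner_syntax

text \<open>On each class of \<open>R\<close> the matrix is a scalar plus \<beta> times the all-ones
  block. Let \<open>v $ i\<close> be non-zero in an eigenvector \<open>v\<close>. Unless
  \<open>l = \<alpha> i\<close>, \<open>v\<close> is constant on the class of \<open>i\<close>, so
  \<open>l\<close> is \<open>\<alpha> i\<close> plus \<beta> times the size of that class.\<close>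

lemma eigenvalue_block_scalar_Ints:
  fixes M :: "complex mat"
  assumes M: "M \<in> carrier_mat n n" and R: "equiv {..<n} R"
    and entry: "\<And>i j. i < n \<Longrightarrow> j < n \<Longrightarrow>
      M $$ (i, j) = (if i = j then \<alpha> i else 0) + (if (i, j) \<in> R then \<beta> else 0)"
    and \<alpha>: "\<And>i. i < n \<Longrightarrow> \<alpha> i \<in> \<int>" and \<beta>: "\<beta> \<in> \<int>"
    and \<alpha>_const: "\<And>i j. (i, j) \<in> R \<Longrightarrow> \<alpha> i = \<alpha> j"
    and ev: "eigenvalue M l"
  shows "l \<in> \<int>"
proof -
  obtain v where v: "v \<in> carrier_vec n" "v \<noteq> 0\<^sub>v n" "M *\<^sub>v v = l \<cdot>\<^sub>v v"
    using ev M unfolding eigenvalue_def eigenvector_def by auto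
  define S where "S i = (\<Sum>j\<in>R `` {i}. v $ j)" for i
  have Rsub: "R `` {i} \<subseteq> {..<n}" for i
    using R by (auto simp: equiv_def refl_on_def)
  have eq: "l * v $ i = \<alpha> i * v $ i + \<beta> * S i" if i: "i < n" for i
  proof -
    have "l * v $ i = (M *\<^sub>v v) $ i"
      using v i by simp
    also have "\<dots> = row M i \<bullet> v"
      using M i by simp
    also have "\<dots> = (\<Sum>j<n. row M i $ j * v $ j)"
      using v(1) by (simp add: scalar_prod_def atLeast0LessThan)
    also have "\<dots> = (\<Sum>j<n. M $$ (i, j) * v $ j)"
      using M i by (intro sum.cong) auto
    also have "\<dots> = (\<Sum>j<n. (if j = i then \<alpha> i * v $ i else 0)) + (\<Sum>j<n. (if (i, j) \<in> R then \<beta> * v $ j else 0))"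
      unfolding sum.distrib [symmetric] using i
      by (intro sum.cong) (auto simp: entry algebra_simps)
    also have "(\<Sum>j<n. (if (i, j) \<in> R then \<beta> * v $ j else 0)) = (\<Sum>j\<in>R `` {i}. \<beta> * v $ j)"
      using Rsub [of i] by (intro sum.mono_neutral_cong_right) auto
    finally show ?thesis
      using i by (simp add: S_def sum_distrib_left)
  qed
  obtain i where i: "i < n" "v $ i \<noteq> 0"
    using v(1,2) by (metis carrier_vecD eq_vecI index_zero_vec)
  show ?thesis
  proof (cases "l = \<alpha> i")
    case True
    then show ?thesis using \<alpha> i by simp
  next
    case False
    have "v $ j = v $ i" if j: "(i, j) \<in> R" for j
    proof -
      have "S j = S i"
        unfolding S_def using equiv_class_eq [OF R j] by simp
      moreover have "j < n"
        using Rsub j by auto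
      ultimately have "(l - \<alpha> i) * v $ j = (l - \<alpha> i) * v $ i"
        using eq [of i] eq [of j] i(1) \<alpha>_const [OF j] by (simp add: algebra_simps)
      then show ?thesis using False by simp
    qed
    then have "S i = of_nat (card (R `` {i})) * v $ i"
      unfolding S_def by simp
    then have "l * v $ i = (\<alpha> i + \<beta> * of_nat (card (R `` {i}))) * v $ i"
      using eq [OF i(1)] by (simp add: algebra_simps)
    then have "l = \<alpha> i + \<beta> * of_nat (card (R `` {i}))"
      using i by simp
    then show ?thesis using \<alpha> [OF i(1)] \<beta> by simp
  qed
qed

section \<open>Commuting graphs that are disjoint unions of cliques\<close>

lemma commuting_edges_iff:
  fixes G (structure)
  shows "{x, y} \<in> commuting_edges G \<longleftrightarrow>
    x \<in> commuting_verts G \<and> y \<in> commuting_verts G \<and> x \<noteq> y \<and> x \<otimes> y = y \<otimes> x"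
  unfolding commuting_edges_def mem_Collect_eq doubleton_eq_iff by metis

lemma super_integral_if_commuting_trans:
  fixes G (structure)
  assumes trans: "\<And>x y z. x \<in> commuting_verts G \<Longrightarrow> y \<in> commuting_verts G \<Longrightarrow> z \<in> commuting_verts G \<Longrightarrow>
    x \<otimes> y = y \<otimes> x \<Longrightarrow> y \<otimes> z = z \<otimes> y \<Longrightarrow> x \<otimes> z = z \<otimes> x"
  shows "super_integral G"
  unfolding super_integral_def
proof (intro allI impI)
  fix vs assume "distinct vs \<and> set vs = commuting_verts G"
  then have vs: "distinct vs" "set vs = commuting_verts G"
    by blast+
  let ?E = "commuting_edges G"
  define n where "n = length vs"
  define R where "R = {(i, j). i < n \<and> j < n \<and> vs ! i \<otimes> vs ! j = vs ! j \<otimes> vs ! i}"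
  have vert: "vs ! i \<in> commuting_verts G" if "i < n" for i
    using that by (simp add: vs(2) [symmetric] n_def)
  have R: "equiv {..<n} R"
  proof (rule equivI)
    show "R \<subseteq> {..<n} \<times> {..<n}" "refl_on {..<n} R" "sym R"
      by (auto simp: R_def refl_on_def sym_def)
    show "Relation.trans R"
      using trans vert unfolding R_def trans_def by blast
  qed
  have edge: "{vs ! i, vs ! j} \<in> ?E \<longleftrightarrow> (i, j) \<in> R \<and> i \<noteq> j" if "i < n" "j < n" for i j
    using that vert by (simp add: commuting_edges_iff R_def n_def nth_eq_iff_index_eq [OF vs(1)]) blast
  \<comment> \<open>The neighbours of a vertex are its class without the vertex itself.\<close>
  have deg: "(of_nat (card {e \<in> ?E. vs ! i \<in> e}) :: complex) = of_nat (card (R `` {i})) - 1" if i: "i < n" for i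
  proof -
    have "bij_betw (\<lambda>j. {vs ! i, vs ! j}) (R `` {i} - {i}) {e \<in> ?E. vs ! i \<in> e}"
      unfolding bij_betw_def
    proof
      show "inj_on (\<lambda>j. {vs ! i, vs ! j}) (R `` {i} - {i})"
        using i unfolding inj_on_def R_def n_def
        by (simp add: doubleton_eq_iff nth_eq_iff_index_eq [OF vs(1)])
      show "(\<lambda>j. {vs ! i, vs ! j}) ` (R `` {i} - {i}) = {e \<in> ?E. vs ! i \<in> e}"
      proof (intro equalityI subsetI)
        fix e assume "e \<in> {e \<in> ?E. vs ! i \<in> e}"
        then obtain y where y: "e = {vs ! i, y}" "y \<in> set vs" "e \<in> ?E"
          unfolding vs(2) commuting_edges_def by blast
        then obtain j where j: "j < n" "y = vs ! j"
          unfolding in_set_conv_nth n_def by blast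
        then have "j \<in> R `` {i} - {i}"
          using y edge [OF i j(1)] by simp
        then show "e \<in> (\<lambda>j. {vs ! i, vs ! j}) ` (R `` {i} - {i})"
          using y(1) j(2) by blast
      next
        fix e assume "e \<in> (\<lambda>j. {vs ! i, vs ! j}) ` (R `` {i} - {i})"
        then obtain j where j: "e = {vs ! i, vs ! j}" "(i, j) \<in> R" "i \<noteq> j"
          by blast
        then have "j < n"
          by (simp add: R_def)
        then show "e \<in> {e \<in> ?E. vs ! i \<in> e}"
          using edge [OF i, of j] j by simp
      qed
    qed
    then have "card {e \<in> ?E. vs ! i \<in> e} = card (R `` {i} - {i})"
      by (simp add: bij_betw_same_card)
    moreover have "finite (R `` {i})" "i \<in> R `` {i}"
      using i by (auto simp: R_def intro: finite_subset [of _ "{..<n}"])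
    moreover from this have "card (R `` {i}) > 0"
      by (auto simp: card_gt_0_iff)
    ultimately show ?thesis
      by simp
  qed
  have Rn: "(i, i) \<in> R" if "i < n" for i
    using that by (simp add: R_def)
  have Rc: "R `` {i} = R `` {j}" if "(i, j) \<in> R" for i j
    using equiv_class_eq [OF R that] .
  \<comment> \<open>\<open>R\<close> is reflexive, so the block part puts \<beta> on the diagonal.
    Each \<alpha> below is the diagonal entry minus \<beta>: the entry is 0 for the adjacency matrix
    and the class size minus 1 for the other two.\<close>
  have A: "eigenvalue (adjacency_matrix ?E vs) l \<Longrightarrow> l \<in> \<int>" for l
    by (rule eigenvalue_block_scalar_Ints [OF _ R, where \<alpha> = "\<lambda>_. -1" and \<beta> = 1])
      (auto simp: adjacency_matrix_def n_def [symmetric] edge Rn)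
  have L: "eigenvalue (laplacian_matrix ?E vs) l \<Longrightarrow> l \<in> \<int>" for l
    by (rule eigenvalue_block_scalar_Ints [OF _ R, where \<alpha> = "\<lambda>i. of_nat (card (R `` {i}))" and \<beta> = "-1"])
      (auto simp: laplacian_matrix_def degree_matrix_def adjacency_matrix_def n_def [symmetric]
        edge Rn deg dest: Rc)
  have Q: "eigenvalue (signless_laplacian_matrix ?E vs) l \<Longrightarrow> l \<in> \<int>" for l
    by (rule eigenvalue_block_scalar_Ints [OF _ R, where \<alpha> = "\<lambda>i. of_nat (card (R `` {i})) - 2" and \<beta> = 1])
      (auto simp: signless_laplacian_matrix_def degree_matrix_def adjacency_matrix_def n_def [symmetric]
        edge Rn deg dest: Rc)
  show "spectrum (adjacency_matrix ?E vs) \<subseteq> \<int> \<and> spectrum (laplacian_matrix ?E vs) \<subseteq> \<int> \<and>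
    spectrum (signless_laplacian_matrix ?E vs) \<subseteq> \<int>"
    using A L Q by (auto simp: spectrum_def)
qed

section \<open>Planar commuting graphs\<close>

theorem theorem5p2:
  fixes G :: "('g, 'b) monoid_scheme"
  assumes "group G" and "finite (carrier G)" and "\<not> comm_group G"
    and "\<not> (G \<cong> sym_group 4)"
    and "planar_graph (commuting_verts G) (commuting_edges G)"
  shows "super_integral G"
proof -
  let ?V = "commuting_verts G" and ?E = "commuting_edges G"
  interpret group G by fact
  have E: "\<Union>?E \<subseteq> ?V"
    by (auto simp: commuting_edges_def)
  have "finite ?V"
    using assms(2) by (simp add: commuting_verts_def)
  then have finE: "finite ?E"
    using E by (intro finite_subset [of ?E "Pow ?V"]) auto
  interpret few_commuting_group G
  proof
    show "finite (carrier G)" by fact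
    fix K assume K: "K \<subseteq> carrier G - group_center G"
      and comm: "\<And>x y. x \<in> K \<Longrightarrow> y \<in> K \<Longrightarrow> x \<otimes>\<^bsub>G\<^esub> y = y \<otimes>\<^bsub>G\<^esub> x"
    show "card K \<le> 4"
    \<comment> \<open>Five commuting non-central elements would span a complete graph.\<close>
    proof (rule ccontr)
      assume "\<not> card K \<le> 4"
      then obtain K' where K': "K' \<subseteq> K" "card K' = 5"
        using obtain_subset_with_card_n [of 5 K] by auto
      have "{x, y} \<in> ?E" if "x \<in> K'" "y \<in> K'" "x \<noteq> y" for x y
      proof -
        have xy: "x \<in> K" "y \<in> K"
          using that K' by blast+
        then have "x \<otimes>\<^bsub>G\<^esub> y = y \<otimes>\<^bsub>G\<^esub> x"
          by (rule comm)
        then show ?thesis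
          unfolding commuting_edges_iff using xy K that(3) by (auto simp: commuting_verts_def)
      qed
      then show False
        using planar_graph_no_K5 [OF assms(5) finE E K'(2)] by blast
    qed
  qed
  show ?thesis
  proof (rule super_integral_if_commuting_trans)
    fix x y z
    assume V: "x \<in> ?V" "y \<in> ?V" "z \<in> ?V"
      and xy: "x \<otimes>\<^bsub>G\<^esub> y = y \<otimes>\<^bsub>G\<^esub> x" and yz: "y \<otimes>\<^bsub>G\<^esub> z = z \<otimes>\<^bsub>G\<^esub> y"
    \<comment> \<open>The centralizer of \<open>y\<close> is abelian and contains \<open>x\<close>
      and \<open>z\<close>.\<close>
    have "C {y} \<subseteq> C (C {y})"
      using iso_sym_group_4_if_nonabelian_centralizer [of y] assms(4) V by (auto simp: commuting_verts_def)
    moreover have "x \<in> C {y}" "z \<in> C {y}"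
      using V xy yz by (auto simp: commuting_verts_def centralizer_def)
    ultimately have "x \<in> C (C {y})" "z \<in> C {y}"
      by blast+
    then show "x \<otimes>\<^bsub>G\<^esub> z = z \<otimes>\<^bsub>G\<^esub> x"
      unfolding centralizer_def [of G "C {y}"] by blast
  qed
qed

end
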